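(* Let $H$ be a nonzero complex Hilbert space and $J$ a nonempty (possibly infinite) set of indices. The Schur block product $\square: M_J(B(H))\times M_J(B(H))\to M_J(B(H))$, $A\,\square\, B=(a_{ij}b_{ij})_{i,j\in J}$, is a completely bounded bilinear operator, with completely bounded norm $\|\square\|_{cb}=1$.
   Context: $M_J(B(H))$ denotes the C$^*$-algebra of all matrices $A=(a_{ij})_{i,j\in J}$ with entries $a_{ij}\in B(H)$ which define bounded operators on $\ell^2(J,H)=\ell^2(J,\mathbb{C})\otimes H$, with the operator norm. For $A,B\in M_J(B(H))$ the entrywise product $A\,\square\, B=(a_{ij}b_{ij})$ again lies in $M_J(B(H))$. Complete boundedness of bilinear maps: let $\mathcal{A},\mathcal{B},\mathcal{C}$ be C$^*$-algebras and $\Phi:\mathcal{A}\times\mathcal{B}\to\mathcal{C}$ bilinear. For each natural number $k\ge1$ define the bilinear map $\Phi^k:M_k(\mathcal{A})\times M_k(\mathcal{B})\to M_k(\mathcal{C})$ by $$(\Phi^k(A,B))_{ij}:=\sum_{l=1}^k\Phi(a_{il},b_{lj}),\qquad 1\le i,j\le k,$$ where $M_k(\cdot)$ carries its C$^*$-norm, and let $\|\Phi^k\|$ be the norm of $\Phi^k$ as a bilinear operator, i.e. $\sup\{\|\Phi^k(A,B)\|:\|A\|\le1,\|B\|\le1\}$. $\Phi$ is completely bounded if there is a constant $K$ with $\|\Phi^k\|\le K$ for all $k$, and then $\|\Phi\|_{cb}:=\sup_k\|\Phi^k\|$. Here this is applied with $\mathcal{A}=\mathcal{B}=\mathcal{C}=M_J(B(H))$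 and $\Phi=\square$; thus $\square^k$ acts on $M_k(M_J(B(H)))$. *)

theory Defs
  imports "HOL-Analysis.Analysis" "Jordan_Normal_Form.Matrix"
begin

section \<open>Complex Hilbert spaces and C*-algebras\<close>

class complex_normed_vector = real_normed_vector +
  fixes scaleC :: "complex \<Rightarrow> 'a \<Rightarrow> 'a" (infixr "*\<^sub>C" 75)
  assumes scaleC_add_right: "c *\<^sub>C (x + y) = c *\<^sub>C x + c *\<^sub>C y"
    and scaleC_add_left: "(c + d) *\<^sub>C x = c *\<^sub>C x + d *\<^sub>C x"
    and scaleC_scaleC: "c *\<^sub>C (d *\<^sub>C x) = (c * d) *\<^sub>C x"
    and scaleC_of_real: "complex_of_real r *\<^sub>C x = r *\<^sub>R x"
    and norm_scaleC: "norm (c *\<^sub>C x) = cmod c * norm x"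

text \<open>The inner product is conjugate linear in its first argument; definiteness is
  contained in \<open>cinner_norm\<close>, completeness in the class \<^class>\<open>banach\<close>.\<close>

class chilbert_space = complex_normed_vector + banach +
  fixes cinner :: "'a \<Rightarrow> 'a \<Rightarrow> complex"
  assumes cinner_commute: "cinner x y = cnj (cinner y x)"
    and cinner_add_left: "cinner (x + y) z = cinner x z + cinner y z"
    and cinner_scaleC_left: "cinner (c *\<^sub>C x) y = cnj c * cinner x y"
    and cinner_norm: "cinner x x = complex_of_real ((norm x)\<^sup>2)"

class cstar_algebra = complex_normed_vector + real_normed_algebra + banach +
  fixes star :: "'a \<Rightarrow> 'a"
  assumes scaleC_mult_left: "(c *\<^sub>C a) * b = c *\<^sub>C (a * b)"
    and scaleC_mult_right: "a * (c *\<^sub>C b) = c *\<^sub>C (a * b)"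
    and star_star: "star (star a) = a"
    and star_add: "star (a + b) = star a + star b"
    and star_scaleC: "star (c *\<^sub>C a) = cnj c *\<^sub>C star a"
    and star_mult: "star (a * b) = star b * star a"
    and norm_star_mult_self: "norm (star a * a) = (norm a)\<^sup>2"

definition clinear :: "('a::complex_normed_vector \<Rightarrow> 'b::complex_normed_vector) \<Rightarrow> bool" where
  "clinear f \<longleftrightarrow> (\<forall>x y. f (x + y) = f x + f y) \<and> (\<forall>c x. f (c *\<^sub>C x) = c *\<^sub>C f x)"

definition bounded_clinear :: "('a::complex_normed_vector \<Rightarrow> 'b::complex_normed_vector) \<Rightarrow> bool" where
  "bounded_clinear f \<longleftrightarrow> clinear f \<and> (\<exists>K. \<forall>x. norm (f x) \<le> K * norm x)"

definition cbilinear ::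
  "('a::complex_normed_vector \<Rightarrow> 'b::complex_normed_vector \<Rightarrow> 'c::complex_normed_vector) \<Rightarrow> bool" where
  "cbilinear \<Phi> \<longleftrightarrow> (\<forall>a. clinear (\<lambda>b. \<Phi> a b)) \<and> (\<forall>b. clinear (\<lambda>a. \<Phi> a b))"

lemma bounded_clinear_bounded_linear:
  assumes "bounded_clinear f"
  shows "bounded_linear f"
proof -
  obtain K where K: "\<And>x. norm (f x) \<le> K * norm x" and f: "clinear f"
    using assms unfolding bounded_clinear_def by blast
  show ?thesis
  proof (rule bounded_linear_intro)
    show "f (x + y) = f x + f y" for x y using f by (simp add: clinear_def)
    show "f (r *\<^sub>R x) = r *\<^sub>R f x" for r x
      using f by (simp add: clinear_def scaleC_of_real[symmetric])
    show "norm (f x) \<le> norm x * K" for x using K[of x] by (simp add: mult.commute)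
  qed
qed

lemma bounded_clinear_scaleC: "bounded_clinear f \<Longrightarrow> f (c *\<^sub>C x) = c *\<^sub>C f x"
  by (simp add: bounded_clinear_def clinear_def)

lemma bounded_clinearI:
  assumes "bounded_linear f" "\<And>c x. f (c *\<^sub>C x) = c *\<^sub>C f x"
  shows "bounded_clinear f"
  using assms bounded_linear.bounded[OF assms(1)] bounded_linear.linear[OF assms(1)]
  unfolding bounded_clinear_def clinear_def by (auto simp: linear_add mult.commute)

lemma bounded_linear_scaleC: "bounded_linear (\<lambda>x::'a::complex_normed_vector. c *\<^sub>C x)"
proof (rule bounded_linear_intro)
  fix x y :: 'a and r :: real
  show "c *\<^sub>C (x + y) = c *\<^sub>C x + c *\<^sub>C y" by (rule scaleC_add_right)
  show "c *\<^sub>C (r *\<^sub>R x) = r *\<^sub>R (c *\<^sub>C x)"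
    by (simp add: scaleC_of_real[symmetric] scaleC_scaleC mult.commute)
  show "norm (c *\<^sub>C x) \<le> norm x * cmod c" by (simp add: norm_scaleC mult.commute)
qed

lemma scaleC_zero_right [simp]: "c *\<^sub>C (0::'a::complex_normed_vector) = 0"
  by (metis norm_eq_zero norm_scaleC mult_zero_right)

lemma scaleC_minus_right: "c *\<^sub>C (- x::'a::complex_normed_vector) = - (c *\<^sub>C x)"
  by (rule linear_neg[OF bounded_linear.linear[OF bounded_linear_scaleC]])

lemma scaleC_diff_right: "c *\<^sub>C (x - y::'a::complex_normed_vector) = c *\<^sub>C x - c *\<^sub>C y"
  by (rule linear_diff[OF bounded_linear.linear[OF bounded_linear_scaleC]])


lemma cinner_add_right: "cinner (x::'a::chilbert_space) (y + z) = cinner x y + cinner x z"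
  by (metis cinner_commute cinner_add_left complex_cnj_add)

lemma cinner_scaleC_right: "cinner (x::'a::chilbert_space) (c *\<^sub>C y) = c * cinner x y"
  by (metis cinner_commute cinner_scaleC_left complex_cnj_mult complex_cnj_cnj)

lemma cinner_zero_left [simp]: "cinner 0 (x::'a::chilbert_space) = 0"
  using cinner_add_left[of 0 0 x] by simp

lemma cinner_zero_right [simp]: "cinner (x::'a::chilbert_space) 0 = 0"
  using cinner_add_right[of x 0 0] by simp

lemma cinner_minus_right: "cinner (x::'a::chilbert_space) (- y) = - cinner x y"
  using cinner_add_right[of x y "- y"] by (simp add: eq_neg_iff_add_eq_0 add.commute)

lemma cinner_diff_right: "cinner (x::'a::chilbert_space) (y - z) = cinner x y - cinner x z"
  using cinner_add_right[of x y "- z"] by (simp add: cinner_minus_right)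

lemma norm_add_square:
  "(norm (x + y::'a::chilbert_space))\<^sup>2 = (norm x)\<^sup>2 + 2 * Re (cinner x y) + (norm y)\<^sup>2"
proof -
  have "cinner (x + y) (x + y) = cinner x x + cinner x y + cnj (cinner x y) + cinner y y"
    by (simp add: cinner_add_left cinner_add_right cinner_commute[of y x])
  then have "Re (cinner (x + y) (x + y)) = Re (cinner x x + cinner x y + cnj (cinner x y) + cinner y y)"
    by simp
  then show ?thesis by (simp add: cinner_norm del: of_real_power)
qed

lemma parallelogram:
  "(norm (x + y::'a::chilbert_space))\<^sup>2 + (norm (x - y))\<^sup>2 = 2 * (norm x)\<^sup>2 + 2 * (norm y)\<^sup>2"
  using norm_add_square[of x y] norm_add_square[of x "- y"] by (simp add: cinner_minus_right)

lemma norm_add_multiple_square: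
  fixes x y :: "'a::chilbert_space"
  shows "(norm (x + (- (of_real t * cnj (cinner x y))) *\<^sub>C y))\<^sup>2
    = (norm x)\<^sup>2 - 2 * t * (cmod (cinner x y))\<^sup>2 + t\<^sup>2 * (cmod (cinner x y))\<^sup>2 * (norm y)\<^sup>2"
proof -
  define c where "c = cinner x y"
  have "cnj c * c = of_real ((cmod c)\<^sup>2)"
    by (metis complex_norm_square mult.commute)
  then have "- (of_real t * cnj c) * c = of_real (- (t * (cmod c)\<^sup>2))"
    by (simp only: mult_minus_left mult.assoc of_real_mult of_real_minus)
  then have "Re (cinner x ((- (of_real t * cnj c)) *\<^sub>C y)) = - (t * (cmod c)\<^sup>2)"
    by (simp only: cinner_scaleC_right c_def[symmetric] Re_complex_of_real)
  moreover have "norm ((- (of_real t * cnj c)) *\<^sub>C y) = \<bar>t\<bar> * cmod c * norm y"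
    by (simp add: norm_scaleC norm_mult)
  ultimately show ?thesis
    unfolding norm_add_square c_def by (simp only: power_mult_distrib power2_abs)
qed

lemma cinner_Cauchy_Schwarz: "cmod (cinner x (y::'a::chilbert_space)) \<le> norm x * norm y"
proof (cases "y = 0")
  case False
  define a where "a = cmod (cinner x y)"
  define n where "n = (norm y)\<^sup>2"
  have n: "n > 0" using False by (simp add: n_def)
  have "0 \<le> (norm x)\<^sup>2 - 2 * (1 / n) * a\<^sup>2 + (1 / n)\<^sup>2 * a\<^sup>2 * n"
    using norm_add_multiple_square[of x "1 / n" y] unfolding a_def n_def
    by (metis zero_le_power2)
  also have "\<dots> = (norm x)\<^sup>2 - a\<^sup>2 / n"
    using n by (simp add: field_simps power2_eq_square)
  finally have "a\<^sup>2 \<le> (norm x)\<^sup>2 * n" using n by (simp add: field_simps)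
  then have "a\<^sup>2 \<le> (norm x * norm y)\<^sup>2" by (simp add: n_def power_mult_distrib)
  then show ?thesis unfolding a_def by (rule power2_le_imp_le) simp
qed simp

lemma cinner_eq_zeroI:
  fixes x y :: "'a::chilbert_space"
  assumes min: "\<And>c. norm x \<le> norm (x + c *\<^sub>C y)"
  shows "cinner x y = 0"
proof (rule ccontr)
  assume "cinner x y \<noteq> 0"
  define a where "a = (cmod (cinner x y))\<^sup>2"
  define n where "n = (norm y)\<^sup>2"
  define t where "t = 1 / (n + 1)"
  have a: "a > 0" using \<open>cinner x y \<noteq> 0\<close> by (simp add: a_def)
  have n: "n \<ge> 0" by (simp add: n_def)
  have t: "t > 0" "t * n < 1" using n by (auto simp: t_def field_simps)
  have "(norm x)\<^sup>2 \<le> (norm x)\<^sup>2 - 2 * t * a + t\<^sup>2 * a * n"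
    using power_mono[OF min[of "- (of_real t * cnj (cinner x y))"], of 2]
    unfolding norm_add_multiple_square a_def n_def by simp
  then have "a * t * (2 - t * n) \<le> 0" by (simp add: algebra_simps power2_eq_square)
  moreover have "a * t * (2 - t * n) > 0" using a t by simp
  ultimately show False by simp
qed

lemma minimal_norm_exists:
  fixes S :: "'a::chilbert_space set"
  assumes ne: "S \<noteq> {}" and cl: "closed S"
    and mid: "\<And>x y. x \<in> S \<Longrightarrow> y \<in> S \<Longrightarrow> (1/2) *\<^sub>R (x + y) \<in> S"
  shows "\<exists>z\<in>S. \<forall>x\<in>S. norm z \<le> norm x"
proof -
  define d where "d = Inf (norm ` S)"
  have bdd: "bdd_below (norm ` S)" by (rule bdd_belowI[of _ 0]) auto
  have d_le: "d \<le> norm x" if "x \<in> S" for x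
    unfolding d_def by (rule cInf_lower[OF _ bdd]) (use that in auto)
  have d0: "d \<ge> 0" unfolding d_def by (rule cInf_greatest) (use ne in auto)
  have "\<exists>x\<in>S. norm x < d + 1 / Suc n" for n
  proof -
    have "Inf (norm ` S) < d + 1 / Suc n" by (simp add: d_def)
    then show ?thesis using cInf_less_iff[OF _ bdd] ne by auto
  qed
  then obtain X where X: "\<And>n. X n \<in> S" "\<And>n. norm (X n) < d + 1 / Suc n" by metis
  have lim: "(\<lambda>n. d + 1 / Suc n) \<longlonglongrightarrow> d"
    using tendsto_add[OF tendsto_const LIMSEQ_inverse_real_of_nat, of d]
    by (simp add: inverse_eq_divide)
  have est: "(norm (X m - X n))\<^sup>2 \<le> 4 * (d + 1 / Suc N)\<^sup>2 - 4 * d\<^sup>2" if "m \<ge> N" "n \<ge> N" for m n N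
  proof -
    have b: "(norm (X k))\<^sup>2 \<le> (d + 1 / Suc N)\<^sup>2" if "k \<ge> N" for k
    proof (rule power_mono)
      have "1 / real (Suc k) \<le> 1 / Suc N" using that by (intro divide_left_mono) auto
      then show "norm (X k) \<le> d + 1 / Suc N" using X(2)[of k] by linarith
    qed simp
    have "d \<le> norm ((1/2) *\<^sub>R (X m + X n))" by (rule d_le[OF mid[OF X(1) X(1)]])
    then have "2 * d \<le> norm (X m + X n)" by simp
    then have "(2 * d)\<^sup>2 \<le> (norm (X m + X n))\<^sup>2" using d0 by (intro power_mono) auto
    then show ?thesis
      using parallelogram[of "X m" "X n"] b[OF that(1)] b[OF that(2)]
      by (simp add: power_mult_distrib)
  qed
  have lim2: "(\<lambda>N. 4 * (d + 1 / Suc N)\<^sup>2 - 4 * d\<^sup>2) \<longlonglongrightarrow> 0"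
    using tendsto_diff[OF tendsto_mult[OF tendsto_const[of 4] tendsto_power[OF lim, of 2]]
        tendsto_const[of "4 * d\<^sup>2"]] by simp
  have "Cauchy X"
  proof (rule metric_CauchyI)
    fix e :: real assume e: "e > 0"
    then obtain N where N: "4 * (d + 1 / Suc N)\<^sup>2 - 4 * d\<^sup>2 < e\<^sup>2"
      using order_tendstoD(2)[OF lim2, of "e\<^sup>2"] by (auto simp: eventually_sequentially)
    have "dist (X m) (X n) < e" if "m \<ge> N" "n \<ge> N" for m n
    proof -
      have "(norm (X m - X n))\<^sup>2 < e\<^sup>2" using est[OF that] N by linarith
      then show ?thesis using e by (simp add: dist_norm power_less_imp_less_base)
    qed
    then show "\<exists>M. \<forall>m\<ge>M. \<forall>n\<ge>M. dist (X m) (X n) < e" by blast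
  qed
  then obtain z where z: "X \<longlonglongrightarrow> z" using Cauchy_convergent convergent_def by blast
  have "z \<in> S" by (rule closed_sequentially[OF cl X(1) z])
  have "norm z \<le> d"
    by (rule LIMSEQ_le[OF tendsto_norm[OF z] lim]) (use X(2) less_imp_le in blast)
  then show ?thesis using \<open>z \<in> S\<close> d_le order_trans by blast
qed

lemma Riesz_representation:
  fixes f :: "'a::chilbert_space \<Rightarrow> complex"
  assumes f: "bounded_linear f" and fC: "\<And>c x. f (c *\<^sub>C x) = c * f x"
  obtains z where "\<And>x. f x = cinner z x"
proof (cases "\<forall>x. f x = 0")
  case True
  then show thesis using that[of 0] by simp
next
  case False
  interpret f: bounded_linear f by fact
  obtain u where u: "f u \<noteq> 0" using False by blast
  define S where "S = {x. f x = 1}"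
  have "inverse (f u) *\<^sub>C u \<in> S" using u by (simp add: S_def fC)
  then have ne: "S \<noteq> {}" by blast
  have cl: "closed S" unfolding S_def
    by (intro closed_Collect_eq continuous_on_const linear_continuous_on f)
  have mid: "(1/2) *\<^sub>R (x + y) \<in> S" if "x \<in> S" "y \<in> S" for x y
    using that by (simp add: S_def f.scaleR f.add scaleR_conv_of_real)
  obtain z where zS: "z \<in> S" "\<And>x. x \<in> S \<Longrightarrow> norm z \<le> norm x"
    using minimal_norm_exists[OF ne cl] mid by blast
  then have z: "f z = 1" and min: "\<And>x. f x = 1 \<Longrightarrow> norm z \<le> norm x" by (simp_all add: S_def)
  have orth: "cinner z y = 0" if "f y = 0" for y
    by (rule cinner_eq_zeroI, rule min) (simp add: f.add fC z that)
  have "z \<noteq> 0" using z f.zero by force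
  have "f x = cinner (of_real (inverse ((norm z)\<^sup>2)) *\<^sub>C z) x" for x
  proof -
    have "cinner z (x - f x *\<^sub>C z) = 0" by (rule orth) (simp add: f.diff fC z)
    then have "cinner z x = f x * of_real ((norm z)\<^sup>2)"
      by (simp add: cinner_diff_right cinner_scaleC_right cinner_norm)
    then show ?thesis using \<open>z \<noteq> 0\<close> by (simp add: cinner_scaleC_left)
  qed
  then show thesis by (rule that)
qed


section \<open>The C*-algebra of bounded operators on a Hilbert space\<close>

typedef (overloaded) 'h bop = "{f :: 'h::chilbert_space \<Rightarrow> 'h. bounded_clinear f}"
  morphisms bop_apply Bop
proof
  show "(\<lambda>x::'h. 0) \<in> {f. bounded_clinear f}"
    by (auto simp: bounded_clinear_def clinear_def intro: exI[of _ 0])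
qed

setup_lifting type_definition_bop

lemma bounded_clinear_bop_apply: "bounded_clinear (bop_apply T)"
  using bop_apply by blast

lemma bounded_linear_bop_apply: "bounded_linear (bop_apply T)"
  by (rule bounded_clinear_bounded_linear[OF bounded_clinear_bop_apply])

lemma bop_apply_scaleC: "bop_apply T (c *\<^sub>C x) = c *\<^sub>C bop_apply T x"
  by (rule bounded_clinear_scaleC[OF bounded_clinear_bop_apply])

lemma bop_eqI: "(\<And>x. bop_apply S x = bop_apply T x) \<Longrightarrow> S = T"
  by (auto simp: bop_apply_inject[symmetric])

lemma cinner_eqI: "(\<And>y. cinner y a = cinner y b) \<Longrightarrow> a = (b::'a::chilbert_space)"
proof -
  assume "\<And>y. cinner y a = cinner y b"
  then have "cinner (a - b) (a - b) = 0" by (simp add: cinner_diff_right)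
  then show ?thesis by (simp add: cinner_norm)
qed

lemma adjoint_exists:
  fixes T :: "'h::chilbert_space bop"
  shows "\<exists>S::'h bop. \<forall>x y. cinner (bop_apply T x) y = cinner x (bop_apply S y)"
proof -
  have "\<exists>z. \<forall>x. cinner y (bop_apply T x) = cinner z x" for y
  proof -
    interpret T: bounded_linear "bop_apply T" by (rule bounded_linear_bop_apply)
    have "bounded_linear (\<lambda>x. cinner y (bop_apply T x))"
    proof (rule bounded_linear_intro)
      show "cinner y (bop_apply T (a + b)) = cinner y (bop_apply T a) + cinner y (bop_apply T b)" for a b
        by (simp add: T.add cinner_add_right)
      show "cinner y (bop_apply T (r *\<^sub>R a)) = r *\<^sub>R cinner y (bop_apply T a)" for r a
        by (simp add: scaleC_of_real[symmetric] bop_apply_scaleC cinner_scaleC_right scaleR_conv_of_real)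
      show "norm (cinner y (bop_apply T a)) \<le> norm a * (norm y * onorm (bop_apply T))" for a
      proof -
        have "cmod (cinner y (bop_apply T a)) \<le> norm y * norm (bop_apply T a)"
          by (rule cinner_Cauchy_Schwarz)
        also have "\<dots> \<le> norm y * (onorm (bop_apply T) * norm a)"
          by (intro mult_left_mono onorm bounded_linear_bop_apply norm_ge_zero)
        finally show ?thesis by (simp add: ac_simps)
      qed
    qed
    moreover have "cinner y (bop_apply T (c *\<^sub>C x)) = c * cinner y (bop_apply T x)" for c x
      by (simp add: bop_apply_scaleC cinner_scaleC_right)
    ultimately show ?thesis using Riesz_representation by metis
  qed
  then obtain g where g: "\<And>x y. cinner y (bop_apply T x) = cinner (g y) x" by metis
  then have g': "cinner (bop_apply T x) y = cinner x (g y)" for x y by (metis cinner_commute)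
  have "g (x + y) = g x + g y" for x y
    by (rule cinner_eqI) (simp only: g'[symmetric] cinner_add_right)
  moreover have "g (c *\<^sub>C x) = c *\<^sub>C g x" for c x
    by (rule cinner_eqI) (simp only: g'[symmetric] cinner_scaleC_right)
  ultimately have "clinear g" unfolding clinear_def by blast
  moreover have "norm (g y) \<le> onorm (bop_apply T) * norm y" for y
  proof (cases "g y = 0")
    case True
    then show ?thesis using onorm_pos_le[OF bounded_linear_bop_apply[of T]] by simp
  next
    case False
    have "of_real ((norm (g y))\<^sup>2) = cinner (bop_apply T (g y)) y" by (simp add: g' cinner_norm)
    then have "(norm (g y))\<^sup>2 = cmod (cinner (bop_apply T (g y)) y)"
      by (metis norm_of_real abs_power2)
    also have "\<dots> \<le> norm (bop_apply T (g y)) * norm y" by (rule cinner_Cauchy_Schwarz)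
    also have "\<dots> \<le> onorm (bop_apply T) * norm (g y) * norm y"
      by (intro mult_right_mono onorm bounded_linear_bop_apply norm_ge_zero)
    finally have "norm (g y) * norm (g y) \<le> norm (g y) * (onorm (bop_apply T) * norm y)"
      by (simp add: power2_eq_square ac_simps)
    then show ?thesis using False by (simp add: mult_le_cancel_left)
  qed
  ultimately have "bounded_clinear g" unfolding bounded_clinear_def by blast
  then show ?thesis using g' by (auto intro!: exI[of _ "Bop g"] simp: Bop_inverse)
qed

instantiation bop :: (chilbert_space) "{complex_normed_vector, real_normed_algebra}"
begin

lift_definition zero_bop :: "'a bop" is "\<lambda>x. 0"
  by (auto simp: bounded_clinear_def clinear_def intro: exI[of _ 0])

lift_definition plus_bop :: "'a bop \<Rightarrow> 'a bop \<Rightarrow> 'a bop" is "\<lambda>f g x. f x + g x"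
  by (rule bounded_clinearI)
    (auto intro!: bounded_linear_add[OF bounded_clinear_bounded_linear bounded_clinear_bounded_linear] simp: bounded_clinear_scaleC scaleC_add_right)

lift_definition uminus_bop :: "'a bop \<Rightarrow> 'a bop" is "\<lambda>f x. - f x"
  by (rule bounded_clinearI)
    (auto intro!: bounded_linear_minus[OF bounded_clinear_bounded_linear] simp: bounded_clinear_scaleC scaleC_minus_right)

lift_definition minus_bop :: "'a bop \<Rightarrow> 'a bop \<Rightarrow> 'a bop" is "\<lambda>f g x. f x - g x"
  by (rule bounded_clinearI)
    (auto intro!: bounded_linear_sub[OF bounded_clinear_bounded_linear bounded_clinear_bounded_linear] simp: bounded_clinear_scaleC scaleC_diff_right)

lift_definition scaleC_bop :: "complex \<Rightarrow> 'a bop \<Rightarrow> 'a bop" is "\<lambda>c f x. c *\<^sub>C f x"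
  by (rule bounded_clinearI)
    (auto intro!: bounded_linear_compose[OF bounded_linear_scaleC bounded_clinear_bounded_linear]
      simp: bounded_clinear_scaleC scaleC_scaleC mult.commute)

definition scaleR_bop :: "real \<Rightarrow> 'a bop \<Rightarrow> 'a bop" where
  "scaleR_bop r T = complex_of_real r *\<^sub>C T"

lift_definition times_bop :: "'a bop \<Rightarrow> 'a bop \<Rightarrow> 'a bop" is "\<lambda>f g x. f (g x)"
  by (rule bounded_clinearI)
    (simp_all add: bounded_linear_compose[OF bounded_clinear_bounded_linear bounded_clinear_bounded_linear]
      bounded_clinear_scaleC)

lift_definition norm_bop :: "'a bop \<Rightarrow> real" is onorm .

definition dist_bop :: "'a bop \<Rightarrow> 'a bop \<Rightarrow> real" where
  "dist_bop S T = norm (S - T)"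

definition uniformity_bop :: "('a bop \<times> 'a bop) filter" where
  "(uniformity :: ('a bop \<times> 'a bop) filter) = (INF e\<in>{0<..}. principal {(x, y). dist x y < e})"

definition open_bop :: "'a bop set \<Rightarrow> bool" where
  "open_bop S = (\<forall>x\<in>S. \<forall>\<^sub>F (x', y) in uniformity. x' = x \<longrightarrow> y \<in> S)"

definition sgn_bop :: "'a bop \<Rightarrow> 'a bop" where
  "sgn_bop x = scaleR (inverse (norm x)) x"

instance
proof
  have apply_bound: "norm (bop_apply T x) \<le> norm T * norm x" for T :: "'a bop" and x
    by (simp add: norm_bop.rep_eq onorm bounded_linear_bop_apply)
  have bound: "norm T \<le> b" if "0 \<le> b" "\<And>x. norm (bop_apply T x) \<le> b * norm x" for T :: "'a bop" and b
    unfolding norm_bop.rep_eq by (rule onorm_bound) (use that in auto)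
  have norm_nonneg: "0 \<le> norm T" for T :: "'a bop"
    by (simp add: norm_bop.rep_eq onorm_pos_le bounded_linear_bop_apply)
  have scaleC_le: "norm (c *\<^sub>C T) \<le> cmod c * norm T" for T :: "'a bop" and c
    by (rule bound)
      (auto simp: norm_nonneg scaleC_bop.rep_eq norm_scaleC mult.assoc intro!: mult_left_mono apply_bound)
  have scC: "norm (c *\<^sub>C T) = cmod c * norm T" for T :: "'a bop" and c
  proof (cases "c = 0")
    case True
    then show ?thesis using scaleC_le[of c T] norm_nonneg[of "c *\<^sub>C T"] by simp
  next
    case False
    have "T = inverse c *\<^sub>C (c *\<^sub>C T)"
      using False by (intro bop_eqI) (simp add: scaleC_bop.rep_eq scaleC_scaleC scaleC_of_real[of 1, simplified])
    then have "norm T \<le> cmod (inverse c) * norm (c *\<^sub>C T)" by (metis scaleC_le)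
    then have "cmod c * norm T \<le> cmod c * (cmod (inverse c) * norm (c *\<^sub>C T))"
      by (rule mult_left_mono) simp
    also have "\<dots> = norm (c *\<^sub>C T)"
      using False by (simp only: mult.assoc[symmetric] norm_mult[symmetric]) simp
    finally have "cmod c * norm T \<le> norm (c *\<^sub>C T)" .
    then show ?thesis using scaleC_le[of c T] by simp
  qed
  have mult_le: "norm (S * T) \<le> norm S * norm T" for S T :: "'a bop"
  proof (rule bound)
    fix x
    have "norm (bop_apply S (bop_apply T x)) \<le> norm S * norm (bop_apply T x)" by (rule apply_bound)
    also have "\<dots> \<le> norm S * (norm T * norm x)" by (intro mult_left_mono apply_bound norm_nonneg)
    finally show "norm (bop_apply (S * T) x) \<le> norm S * norm T * norm x"
      by (simp add: times_bop.rep_eq mult.assoc)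
  qed (simp add: norm_nonneg)
  fix a b c :: "'a bop" and r s :: real and u v :: complex
  note rep_eqs = zero_bop.rep_eq plus_bop.rep_eq uminus_bop.rep_eq minus_bop.rep_eq scaleC_bop.rep_eq
    times_bop.rep_eq
  show "a + b + c = a + (b + c)" "a + b = b + a" "0 + a = a" "- a + a = 0" "a - b = a + - b"
    by (rule bop_eqI, simp add: rep_eqs ac_simps)+
  show "r *\<^sub>R (a + b) = r *\<^sub>R a + r *\<^sub>R b" "(r + s) *\<^sub>R a = r *\<^sub>R a + s *\<^sub>R a"
    "r *\<^sub>R s *\<^sub>R a = (r * s) *\<^sub>R a" "1 *\<^sub>R a = a"
    unfolding scaleR_bop_def
    by (rule bop_eqI, simp add: rep_eqs scaleC_add_right scaleC_add_left scaleC_scaleC scaleC_of_real[of 1, simplified])+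
  show "dist a b = norm (a - b)" by (rule dist_bop_def)
  show "sgn a = inverse (norm a) *\<^sub>R a" by (rule sgn_bop_def)
  show "(uniformity :: ('a bop \<times> 'a bop) filter) = (INF e\<in>{0<..}. principal {(x, y). dist x y < e})"
    by (rule uniformity_bop_def)
  show "open U = (\<forall>x\<in>U. \<forall>\<^sub>F (x', y) in uniformity. x' = x \<longrightarrow> y \<in> U)" for U :: "'a bop set"
    by (rule open_bop_def)
  show "(norm a = 0) = (a = 0)"
    by transfer (auto simp: onorm_eq_0 bounded_clinear_bounded_linear)
  show "norm (a + b) \<le> norm a + norm b"
    by transfer (intro onorm_triangle bounded_clinear_bounded_linear)
  show "norm (r *\<^sub>R a) = \<bar>r\<bar> * norm a" by (simp add: scaleR_bop_def scC)
  show "u *\<^sub>C (a + b) = u *\<^sub>C a + u *\<^sub>C b" "(u + v) *\<^sub>C a = u *\<^sub>C a + v *\<^sub>C a"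
    "u *\<^sub>C v *\<^sub>C a = (u * v) *\<^sub>C a"
    by (rule bop_eqI, simp add: rep_eqs scaleC_add_right scaleC_add_left scaleC_scaleC)+
  show "complex_of_real r *\<^sub>C a = r *\<^sub>R a" by (simp add: scaleR_bop_def)
  show "norm (u *\<^sub>C a) = cmod u * norm a" by (rule scC)
  have lin: "bop_apply T (x + y) = bop_apply T x + bop_apply T y" for T :: "'a bop" and x y
    by (simp add: linear_add bounded_linear.linear bounded_linear_bop_apply)
  show "a * b * c = a * (b * c)" by (rule bop_eqI) (simp add: rep_eqs)
  show "(a + b) * c = a * c + b * c" by (rule bop_eqI) (simp add: rep_eqs)
  show "a * (b + c) = a * b + a * c"
    by (rule bop_eqI) (simp add: times_bop.rep_eq plus_bop.rep_eq lin)
  show "r *\<^sub>R a * b = r *\<^sub>R (a * b)" unfolding scaleR_bop_def by (rule bop_eqI) (simp add: rep_eqs)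
  show "a * r *\<^sub>R b = r *\<^sub>R (a * b)" unfolding scaleR_bop_def
    by (rule bop_eqI) (simp add: times_bop.rep_eq scaleC_bop.rep_eq bop_apply_scaleC)
  show "norm (a * b) \<le> norm a * norm b" by (rule mult_le)
qed

end

lemma norm_bop_apply: "norm (bop_apply T x) \<le> norm T * norm x"
  by (simp add: norm_bop.rep_eq onorm bounded_linear_bop_apply)

lemma norm_bop_bound: "0 \<le> b \<Longrightarrow> (\<And>x. norm (bop_apply T x) \<le> b * norm x) \<Longrightarrow> norm T \<le> b"
  unfolding norm_bop.rep_eq by (rule onorm_bound)

instance bop :: (chilbert_space) banach
proof
  fix X :: "nat \<Rightarrow> 'a bop"
  assume X: "Cauchy X"
  define B where "B n = Blinfun (bop_apply (X n))" for n
  have B: "blinfun_apply (B n) = bop_apply (X n)" for n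
    by (simp add: B_def bounded_linear_Blinfun_apply bounded_linear_bop_apply)
  have "dist (B m) (B n) = dist (X m) (X n)" for m n
    unfolding dist_norm norm_blinfun.rep_eq norm_bop.rep_eq minus_bop.rep_eq
    by (rule arg_cong[where f = onorm]) (simp add: fun_eq_iff blinfun.diff_left B)
  then have "Cauchy B" using X by (simp add: Cauchy_def)
  then obtain L where L: "B \<longlonglongrightarrow> L" using Cauchy_convergent convergent_def by blast
  have Lx: "(\<lambda>n. bop_apply (X n) x) \<longlonglongrightarrow> blinfun_apply L x" for x
    using blinfun.tendsto[OF L tendsto_const, of x] by (simp add: B)
  have "blinfun_apply L (c *\<^sub>C x) = c *\<^sub>C blinfun_apply L x" for c x
  proof (rule LIMSEQ_unique[OF Lx])
    show "(\<lambda>n. bop_apply (X n) (c *\<^sub>C x)) \<longlonglongrightarrow> c *\<^sub>C blinfun_apply L x"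
      unfolding bop_apply_scaleC by (rule bounded_linear.tendsto[OF bounded_linear_scaleC Lx])
  qed
  then have "bounded_clinear (blinfun_apply L)"
    by (intro bounded_clinearI blinfun.bounded_linear_right)
  then have app: "bop_apply (Bop (blinfun_apply L)) = blinfun_apply L" by (simp add: Bop_inverse)
  have "dist (X n) (Bop (blinfun_apply L)) = dist (B n) L" for n
    unfolding dist_norm norm_blinfun.rep_eq norm_bop.rep_eq minus_bop.rep_eq
    by (rule arg_cong[where f = onorm]) (simp add: fun_eq_iff blinfun.diff_left B app)
  then have "X \<longlonglongrightarrow> Bop (blinfun_apply L)"
    using L unfolding lim_sequentially by simp
  then show "convergent X" by (rule convergentI)
qed

instantiation bop :: (chilbert_space) cstar_algebra
begin

definition star_bop :: "'a bop \<Rightarrow> 'a bop" where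
  "star_bop T = (SOME S. \<forall>x y. cinner (bop_apply T x) y = cinner x (bop_apply S y))"

instance
proof
  have adj: "cinner (bop_apply T x) y = cinner x (bop_apply (star T) y)" for T :: "'a bop" and x y
    using someI_ex[OF adjoint_exists[of T]] unfolding star_bop_def by blast
  have adj2: "cinner x (bop_apply T y) = cinner (bop_apply (star T) x) y" for T :: "'a bop" and x y
    by (metis adj cinner_commute)
  have adj_unique: "star T = S" if "\<And>x y. cinner (bop_apply T x) y = cinner x (bop_apply S y)" for S T :: "'a bop"
    by (intro bop_eqI cinner_eqI) (simp add: adj[symmetric] that)
  have ss: "star (star T) = T" for T :: "'a bop" by (rule adj_unique) (simp add: adj2)
  have norm_le_star: "norm T * norm T \<le> norm (star T * T)" for T :: "'a bop"
  proof -
    have "norm T \<le> sqrt (norm (star T * T))"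
    proof (rule norm_bop_bound)
      fix x
      have "of_real ((norm (bop_apply T x))\<^sup>2) = cinner x (bop_apply (star T * T) x)"
        by (simp only: cinner_norm[symmetric] adj times_bop.rep_eq)
      then have "(norm (bop_apply T x))\<^sup>2 = cmod (cinner x (bop_apply (star T * T) x))"
        by (metis norm_of_real abs_power2)
      also have "\<dots> \<le> norm x * norm (bop_apply (star T * T) x)" by (rule cinner_Cauchy_Schwarz)
      also have "\<dots> \<le> norm x * (norm (star T * T) * norm x)"
        by (intro mult_left_mono norm_bop_apply norm_ge_zero)
      also have "\<dots> = (sqrt (norm (star T * T)) * norm x)\<^sup>2"
        using norm_ge_zero by (simp add: power_mult_distrib power2_eq_square ac_simps)
      finally show "norm (bop_apply T x) \<le> sqrt (norm (star T * T)) * norm x"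
        by (rule power2_le_imp_le) simp
    qed simp
    then have "(norm T)\<^sup>2 \<le> (sqrt (norm (star T * T)))\<^sup>2" by (intro power_mono norm_ge_zero)
    then show ?thesis using norm_ge_zero by (simp add: power2_eq_square)
  qed
  have le_star: "norm T \<le> norm (star T)" for T :: "'a bop"
  proof (cases "norm T = 0")
    case False
    then show ?thesis using order_trans[OF norm_le_star[of T] norm_mult_ineq]
      by (simp add: mult_le_cancel_right)
  qed simp
  have star_eq: "norm (star T) = norm T" for T :: "'a bop"
    using le_star[of T] le_star[of "star T"] by (simp only: ss order_antisym)
  note rep_eqs = plus_bop.rep_eq scaleC_bop.rep_eq times_bop.rep_eq
  fix a b :: "'a bop" and u :: complex
  show "u *\<^sub>C a * b = u *\<^sub>C (a * b)" by (rule bop_eqI) (simp add: rep_eqs)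
  show "a * u *\<^sub>C b = u *\<^sub>C (a * b)"
    by (rule bop_eqI) (simp add: times_bop.rep_eq scaleC_bop.rep_eq bop_apply_scaleC)
  show "star (star a) = a" by (rule ss)
  show "star (a + b) = star a + star b"
    by (rule adj_unique) (simp add: plus_bop.rep_eq cinner_add_left cinner_add_right adj)
  show "star (u *\<^sub>C a) = cnj u *\<^sub>C star a"
    by (rule adj_unique) (simp add: scaleC_bop.rep_eq cinner_scaleC_left cinner_scaleC_right adj)
  show "star (a * b) = star b * star a"
    by (rule adj_unique) (simp add: times_bop.rep_eq adj)
  show "norm (star a * a) = (norm a)\<^sup>2"
    using norm_le_star[of a] norm_mult_ineq[of "star a" a] unfolding star_eq power2_eq_square
    by (rule order_antisym[rotated])
qed

end


section \<open>The Hilbert space of square summable families\<close>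

typedef (overloaded) ('j, 'h) ell2 =
  "{x :: 'j \<Rightarrow> 'h::chilbert_space. (\<lambda>j. (norm (x j))\<^sup>2) summable_on UNIV}"
  morphisms ell2_nth Ell2
  by (rule exI[of _ "\<lambda>_. 0"]) simp

setup_lifting type_definition_ell2

lemma ell2_eqI: "(\<And>j. ell2_nth x j = ell2_nth y j) \<Longrightarrow> x = y"
  by (auto simp: ell2_nth_inject[symmetric])

lemma square_summable_iff_L2_set:
  "(\<lambda>j. (norm (x j :: 'h::real_normed_vector))\<^sup>2) summable_on UNIV
    \<longleftrightarrow> (\<exists>b. \<forall>F. finite F \<longrightarrow> L2_set (\<lambda>j. norm (x j)) F \<le> b)"
proof
  assume s: "(\<lambda>j. (norm (x j))\<^sup>2) summable_on UNIV"
  have "L2_set (\<lambda>j. norm (x j)) F \<le> sqrt (\<Sum>\<^sub>\<infinity>j. (norm (x j))\<^sup>2)" if "finite F" for F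
    unfolding L2_set_def using that by (intro real_sqrt_le_mono finite_sum_le_infsum s) auto
  then show "\<exists>b. \<forall>F. finite F \<longrightarrow> L2_set (\<lambda>j. norm (x j)) F \<le> b" by blast
next
  assume "\<exists>b. \<forall>F. finite F \<longrightarrow> L2_set (\<lambda>j. norm (x j)) F \<le> b"
  then obtain b where b: "\<And>F. finite F \<Longrightarrow> L2_set (\<lambda>j. norm (x j)) F \<le> b" by blast
  show "(\<lambda>j. (norm (x j))\<^sup>2) summable_on UNIV"
  proof (rule nonneg_bdd_above_summable_on)
    have "(\<Sum>j\<in>F. (norm (x j))\<^sup>2) \<le> b\<^sup>2" if "finite F" for F
      using power_mono[OF b[OF that], of 2] by (simp add: L2_set_def sum_nonneg)
    then show "bdd_above (sum (\<lambda>j. (norm (x j))\<^sup>2) ` {F. F \<subseteq> UNIV \<and> finite F})"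
      by (intro bdd_aboveI2[of _ _ "b\<^sup>2"]) auto
  qed simp
qed

lemma L2_set_norm_add:
  "L2_set (\<lambda>j. norm (x j + y j :: 'h::real_normed_vector)) F
    \<le> L2_set (\<lambda>j. norm (x j)) F + L2_set (\<lambda>j. norm (y j)) F"
  by (rule order_trans[OF L2_set_mono L2_set_triangle_ineq]) (auto intro: norm_triangle_ineq)

lemma L2_set_norm_scaleC:
  "L2_set (\<lambda>j. norm (c *\<^sub>C x j :: 'h::complex_normed_vector)) F = cmod c * L2_set (\<lambda>j. norm (x j)) F"
  by (simp add: norm_scaleC L2_set_right_distrib)

lemma square_summable_add:
  assumes "(\<lambda>j. (norm (x j :: 'h::real_normed_vector))\<^sup>2) summable_on UNIV"
    and "(\<lambda>j. (norm (y j))\<^sup>2) summable_on UNIV"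
  shows "(\<lambda>j. (norm (x j + y j))\<^sup>2) summable_on UNIV"
proof -
  obtain b c where "\<And>F. finite F \<Longrightarrow> L2_set (\<lambda>j. norm (x j)) F \<le> b"
    and "\<And>F. finite F \<Longrightarrow> L2_set (\<lambda>j. norm (y j)) F \<le> c"
    using assms unfolding square_summable_iff_L2_set by blast
  then have "L2_set (\<lambda>j. norm (x j + y j)) F \<le> b + c" if "finite F" for F
    using that by (intro order_trans[OF L2_set_norm_add] add_mono)
  then show ?thesis unfolding square_summable_iff_L2_set by blast
qed

lemma square_summable_scaleC:
  assumes "(\<lambda>j. (norm (x j :: 'h::complex_normed_vector))\<^sup>2) summable_on UNIV"
  shows "(\<lambda>j. (norm (c *\<^sub>C x j))\<^sup>2) summable_on UNIV"
  unfolding norm_scaleC power_mult_distrib by (rule summable_on_cmult_right[OF assms])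

instantiation ell2 :: (type, chilbert_space) complex_normed_vector
begin

lift_definition zero_ell2 :: "('a, 'b) ell2" is "\<lambda>_. 0" by simp

lift_definition plus_ell2 :: "('a, 'b) ell2 \<Rightarrow> ('a, 'b) ell2 \<Rightarrow> ('a, 'b) ell2" is "\<lambda>x y j. x j + y j"
  by (rule square_summable_add)

lift_definition uminus_ell2 :: "('a, 'b) ell2 \<Rightarrow> ('a, 'b) ell2" is "\<lambda>x j. - x j" by simp

definition minus_ell2 :: "('a, 'b) ell2 \<Rightarrow> ('a, 'b) ell2 \<Rightarrow> ('a, 'b) ell2" where
  "minus_ell2 x y = x + - y"

lift_definition scaleC_ell2 :: "complex \<Rightarrow> ('a, 'b) ell2 \<Rightarrow> ('a, 'b) ell2" is "\<lambda>c x j. c *\<^sub>C x j"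
  by (rule square_summable_scaleC)

definition scaleR_ell2 :: "real \<Rightarrow> ('a, 'b) ell2 \<Rightarrow> ('a, 'b) ell2" where
  "scaleR_ell2 r x = complex_of_real r *\<^sub>C x"

lift_definition norm_ell2 :: "('a, 'b) ell2 \<Rightarrow> real" is "\<lambda>x. sqrt (\<Sum>\<^sub>\<infinity>j. (norm (x j))\<^sup>2)" .

definition dist_ell2 :: "('a, 'b) ell2 \<Rightarrow> ('a, 'b) ell2 \<Rightarrow> real" where
  "dist_ell2 x y = norm (x - y)"

definition uniformity_ell2 :: "(('a, 'b) ell2 \<times> ('a, 'b) ell2) filter" where
  "uniformity_ell2 = (INF e\<in>{0<..}. principal {(x, y). dist x y < e})"

definition open_ell2 :: "('a, 'b) ell2 set \<Rightarrow> bool" where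
  "open_ell2 S = (\<forall>x\<in>S. \<forall>\<^sub>F (x', y) in uniformity. x' = x \<longrightarrow> y \<in> S)"

definition sgn_ell2 :: "('a, 'b) ell2 \<Rightarrow> ('a, 'b) ell2" where
  "sgn_ell2 x = scaleR (inverse (norm x)) x"

lemma ell2_nth_summable: "(\<lambda>j. (norm (ell2_nth (x::('a, 'b) ell2) j))\<^sup>2) summable_on UNIV"
  using ell2_nth[of x] by simp

lemma L2_set_le_norm_ell2:
  "finite F \<Longrightarrow> L2_set (\<lambda>j. norm (ell2_nth (x::('a, 'b) ell2) j)) F \<le> norm x"
  unfolding L2_set_def norm_ell2.rep_eq
  by (intro real_sqrt_le_mono finite_sum_le_infsum ell2_nth_summable) auto

lemma norm_ell2_leI:
  assumes "\<And>F. finite F \<Longrightarrow> L2_set (\<lambda>j. norm (ell2_nth (x::('a, 'b) ell2) j)) F \<le> b"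
  shows "norm x \<le> b"
proof -
  have b0: "0 \<le> b" using assms[of "{}"] by simp
  have "(\<Sum>\<^sub>\<infinity>j. (norm (ell2_nth x j))\<^sup>2) \<le> b\<^sup>2"
  proof (rule infsum_le_finite_sums[OF ell2_nth_summable])
    show "(\<Sum>j\<in>F. (norm (ell2_nth x j))\<^sup>2) \<le> b\<^sup>2" if "finite F" for F
      using power_mono[OF assms[OF that], of 2] by (simp add: L2_set_def sum_nonneg)
  qed
  then show ?thesis unfolding norm_ell2.rep_eq using b0 by (simp add: real_le_lsqrt)
qed

lemma norm_ell2_nth_le: "norm (ell2_nth (x::('a, 'b) ell2) j) \<le> norm x"
  using L2_set_le_norm_ell2[of "{j}" x] by simp

instance
proof
  note rep_eqs = zero_ell2.rep_eq plus_ell2.rep_eq uminus_ell2.rep_eq scaleC_ell2.rep_eq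
  have scaleC_le: "norm (c *\<^sub>C x) \<le> cmod c * norm x" for x :: "('a, 'b) ell2" and c
    by (rule norm_ell2_leI)
      (simp add: scaleC_ell2.rep_eq L2_set_norm_scaleC mult_left_mono L2_set_le_norm_ell2)
  have nn: "0 \<le> norm x" for x :: "('a, 'b) ell2"
    using L2_set_le_norm_ell2[of "{}" x] by simp
  have scC: "norm (c *\<^sub>C x) = cmod c * norm x" for x :: "('a, 'b) ell2" and c
  proof (cases "c = 0")
    case True
    then show ?thesis using scaleC_le[of c x] nn[of "c *\<^sub>C x"] by simp
  next
    case False
    have "x = inverse c *\<^sub>C (c *\<^sub>C x)"
      using False by (intro ell2_eqI) (simp add: rep_eqs scaleC_scaleC scaleC_of_real[of 1, simplified])
    then have "norm x \<le> cmod (inverse c) * norm (c *\<^sub>C x)" by (metis scaleC_le)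
    then have "cmod c * norm x \<le> cmod c * (cmod (inverse c) * norm (c *\<^sub>C x))"
      by (rule mult_left_mono) simp
    also have "\<dots> = norm (c *\<^sub>C x)"
      using False by (simp only: mult.assoc[symmetric] norm_mult[symmetric]) simp
    finally have "cmod c * norm x \<le> norm (c *\<^sub>C x)" .
    then show ?thesis using scaleC_le[of c x] by simp
  qed
  fix x y z :: "('a, 'b) ell2" and r s :: real and u v :: complex
  show "x + y + z = x + (y + z)" "x + y = y + x" "0 + x = x" "- x + x = 0"
    by (rule ell2_eqI, simp add: rep_eqs ac_simps)+
  show "x - y = x + - y" by (rule minus_ell2_def)
  show "r *\<^sub>R (x + y) = r *\<^sub>R x + r *\<^sub>R y" "(r + s) *\<^sub>R x = r *\<^sub>R x + s *\<^sub>R x"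
    "r *\<^sub>R s *\<^sub>R x = (r * s) *\<^sub>R x" "1 *\<^sub>R x = x"
    unfolding scaleR_ell2_def
    by (rule ell2_eqI, simp add: rep_eqs scaleC_add_right scaleC_add_left scaleC_scaleC scaleC_of_real[of 1, simplified])+
  show "dist x y = norm (x - y)" by (rule dist_ell2_def)
  show "sgn x = inverse (norm x) *\<^sub>R x" by (rule sgn_ell2_def)
  show "(uniformity :: (('a, 'b) ell2 \<times> ('a, 'b) ell2) filter) = (INF e\<in>{0<..}. principal {(x, y). dist x y < e})"
    by (rule uniformity_ell2_def)
  show "open U = (\<forall>x\<in>U. \<forall>\<^sub>F (x', y) in uniformity. x' = x \<longrightarrow> y \<in> U)" for U :: "('a, 'b) ell2 set"
    by (rule open_ell2_def)
  show "(norm x = 0) = (x = 0)"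
  proof
    assume "norm x = 0"
    then have "norm (ell2_nth x j) \<le> 0" for j using norm_ell2_nth_le[of x j] by simp
    then show "x = 0" by (intro ell2_eqI) (simp add: rep_eqs)
  qed (simp add: norm_ell2.rep_eq rep_eqs)
  show "norm (x + y) \<le> norm x + norm y"
  proof (rule norm_ell2_leI)
    fix F :: "'a set" assume "finite F"
    show "L2_set (\<lambda>j. norm (ell2_nth (x + y) j)) F \<le> norm x + norm y"
      unfolding plus_ell2.rep_eq
      by (intro order_trans[OF L2_set_norm_add] add_mono L2_set_le_norm_ell2 \<open>finite F\<close>)
  qed
  show "norm (r *\<^sub>R x) = \<bar>r\<bar> * norm x" by (simp add: scaleR_ell2_def scC)
  show "u *\<^sub>C (x + y) = u *\<^sub>C x + u *\<^sub>C y" "(u + v) *\<^sub>C x = u *\<^sub>C x + v *\<^sub>C x"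
    "u *\<^sub>C v *\<^sub>C x = (u * v) *\<^sub>C x"
    by (rule ell2_eqI, simp add: rep_eqs scaleC_add_right scaleC_add_left scaleC_scaleC)+
  show "complex_of_real r *\<^sub>C x = r *\<^sub>R x" by (simp add: scaleR_ell2_def)
  show "norm (u *\<^sub>C x) = cmod u * norm x" by (rule scC)
qed

end

lemma ell2_nth_add [simp]: "ell2_nth (x + y) j = ell2_nth x j + ell2_nth y j"
  by (simp add: plus_ell2.rep_eq)

lemma ell2_nth_diff [simp]: "ell2_nth (x - y) j = ell2_nth x j - ell2_nth y j"
  unfolding minus_ell2_def plus_ell2.rep_eq uminus_ell2.rep_eq by simp

lemma ell2_nth_zero [simp]: "ell2_nth 0 j = 0"
  by (simp add: zero_ell2.rep_eq)

lemma ell2_nth_scaleC [simp]: "ell2_nth (c *\<^sub>C x) j = c *\<^sub>C ell2_nth x j"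
  by (simp add: scaleC_ell2.rep_eq)

lemma ell2_nth_sum [simp]: "ell2_nth (sum f S) j = (\<Sum>s\<in>S. ell2_nth (f s) j)"
  by (induction S rule: infinite_finite_induct) auto

lemma bounded_clinear_ell2_nth: "bounded_clinear (\<lambda>x. ell2_nth x j)"
  unfolding bounded_clinear_def clinear_def
  by (auto intro!: exI[of _ 1] simp: norm_ell2_nth_le)

instance ell2 :: (type, chilbert_space) banach
proof
  fix X :: "nat \<Rightarrow> ('a, 'b) ell2"
  assume X: "Cauchy X"
  have "\<exists>l. (\<lambda>n. ell2_nth (X n) j) \<longlonglongrightarrow> l" for j
    using bounded_linear.Cauchy[OF bounded_clinear_bounded_linear[OF bounded_clinear_ell2_nth] X]
    by (simp add: Cauchy_convergent_iff convergent_def)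
  then obtain l where l: "\<And>j. (\<lambda>n. ell2_nth (X n) j) \<longlonglongrightarrow> l j" by metis
  have est: "\<exists>N. \<forall>n\<ge>N. \<forall>F. finite F \<longrightarrow> L2_set (\<lambda>j. norm (ell2_nth (X n) j - l j)) F \<le> e"
    if e: "e > 0" for e
  proof -
    obtain N where N: "\<And>m n. m \<ge> N \<Longrightarrow> n \<ge> N \<Longrightarrow> norm (X m - X n) < e"
      using CauchyD[OF X e] by blast
    have "L2_set (\<lambda>j. norm (ell2_nth (X n) j - l j)) F \<le> e" if n: "n \<ge> N" and F: "finite F" for n F
    proof (rule tendsto_upperbound)
      show "((\<lambda>m. L2_set (\<lambda>j. norm (ell2_nth (X n) j - ell2_nth (X m) j)) F) \<longlongrightarrow>
          L2_set (\<lambda>j. norm (ell2_nth (X n) j - l j)) F) sequentially"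
        unfolding L2_set_def by (intro tendsto_intros l)
      have "L2_set (\<lambda>j. norm (ell2_nth (X n) j - ell2_nth (X m) j)) F \<le> e" if "m \<ge> N" for m
        using L2_set_le_norm_ell2[OF F, of "X n - X m"] N[OF n that] by simp
      then show "\<forall>\<^sub>F m in sequentially. L2_set (\<lambda>j. norm (ell2_nth (X n) j - ell2_nth (X m) j)) F \<le> e"
        unfolding eventually_sequentially by blast
    qed simp
    then show ?thesis by blast
  qed
  obtain N where N: "\<And>F. finite F \<Longrightarrow> L2_set (\<lambda>j. norm (ell2_nth (X N) j - l j)) F \<le> 1"
    using est[of 1] by auto
  have neg: "- 1 *\<^sub>C z = - z" for z :: 'b
    using scaleC_of_real[of "- 1" z] by simp
  have "(\<lambda>j. (norm (- 1 *\<^sub>C (ell2_nth (X N) j - l j)))\<^sup>2) summable_on UNIV"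
    by (rule square_summable_scaleC) (use N in \<open>auto simp: square_summable_iff_L2_set\<close>)
  then have "(\<lambda>j. (norm (ell2_nth (X N) j + - 1 *\<^sub>C (ell2_nth (X N) j - l j)))\<^sup>2) summable_on UNIV"
    by (rule square_summable_add[OF ell2_nth_summable])
  then have "(\<lambda>j. (norm (l j))\<^sup>2) summable_on UNIV"
    by (simp add: neg)
  then have L: "ell2_nth (Ell2 l) = l" by (simp add: Ell2_inverse)
  have "X \<longlonglongrightarrow> Ell2 l"
  proof (rule LIMSEQ_I)
    fix r :: real assume "r > 0"
    then obtain N where N: "\<And>n F. n \<ge> N \<Longrightarrow> finite F \<Longrightarrow> L2_set (\<lambda>j. norm (ell2_nth (X n) j - l j)) F \<le> r / 2"
      using est[of "r / 2"] by auto
    have "norm (X n - Ell2 l) \<le> r / 2" if "n \<ge> N" for n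
      by (rule norm_ell2_leI) (simp only: ell2_nth_diff L N that)
    then show "\<exists>no. \<forall>n\<ge>no. norm (X n - Ell2 l) < r"
      using \<open>r > 0\<close> by (intro exI[of _ N]) force
  qed
  then show "convergent X" by (rule convergentI)
qed

lemma cinner_ell2_summable:
  "(\<lambda>j. cinner (ell2_nth (x::('a, 'b::chilbert_space) ell2) j) (ell2_nth y j)) summable_on UNIV"
proof (rule abs_summable_summable, rule Infinite_Sum.abs_summable_on_comparison_test)
  show "(\<lambda>j. norm ((norm (ell2_nth x j))\<^sup>2 + (norm (ell2_nth y j))\<^sup>2)) summable_on UNIV"
    using summable_on_add[OF ell2_nth_summable ell2_nth_summable, of x y] by simp
  fix j
  have "cmod (cinner (ell2_nth x j) (ell2_nth y j)) \<le> norm (ell2_nth x j) * norm (ell2_nth y j)"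
    by (rule cinner_Cauchy_Schwarz)
  also have "\<dots> \<le> (norm (ell2_nth x j))\<^sup>2 + (norm (ell2_nth y j))\<^sup>2"
  proof -
    have "2 * (norm (ell2_nth x j) * norm (ell2_nth y j)) \<le> (norm (ell2_nth x j))\<^sup>2 + (norm (ell2_nth y j))\<^sup>2"
      using sum_squares_bound[of "norm (ell2_nth x j)" "norm (ell2_nth y j)"] by (simp add: mult.assoc)
    moreover have "0 \<le> norm (ell2_nth x j) * norm (ell2_nth y j)" by simp
    ultimately show ?thesis by linarith
  qed
  finally show "cmod (cinner (ell2_nth x j) (ell2_nth y j))
      \<le> norm ((norm (ell2_nth x j))\<^sup>2 + (norm (ell2_nth y j))\<^sup>2)" by simp
qed

instantiation ell2 :: (type, chilbert_space) chilbert_space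
begin

definition cinner_ell2 :: "('a, 'b) ell2 \<Rightarrow> ('a, 'b) ell2 \<Rightarrow> complex" where
  "cinner_ell2 x y = (\<Sum>\<^sub>\<infinity>j. cinner (ell2_nth x j) (ell2_nth y j))"

instance
proof
  fix x y z :: "('a, 'b) ell2" and c :: complex
  show "cinner x y = cnj (cinner y x)"
    unfolding cinner_ell2_def infsum_cnj[symmetric] by (simp add: cinner_commute[symmetric])
  show "cinner (x + y) z = cinner x z + cinner y z"
    by (simp add: cinner_ell2_def cinner_add_left infsum_add cinner_ell2_summable)
  show "cinner (c *\<^sub>C x) y = cnj c * cinner x y"
    by (simp add: cinner_ell2_def cinner_scaleC_left infsum_cmult_right')
  have "cinner x x = (\<Sum>\<^sub>\<infinity>j. complex_of_real ((norm (ell2_nth x j))\<^sup>2))"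
    by (simp add: cinner_ell2_def cinner_norm)
  also have "\<dots> = complex_of_real (\<Sum>\<^sub>\<infinity>j. (norm (ell2_nth x j))\<^sup>2)"
    by (rule infsumI[OF has_sum_bounded_linear[OF bounded_linear_of_real has_sum_infsum[OF ell2_nth_summable]]])
  also have "(\<Sum>\<^sub>\<infinity>j. (norm (ell2_nth x j))\<^sup>2) = (norm x)\<^sup>2"
    by (simp add: norm_ell2.rep_eq infsum_nonneg)
  finally show "cinner x x = complex_of_real ((norm x)\<^sup>2)" .
qed

end


lift_definition ell2_single :: "'j \<Rightarrow> 'h::chilbert_space \<Rightarrow> ('j, 'h) ell2"
  is "\<lambda>i h j. if j = i then h else 0"
proof -
  fix i :: 'j and h :: 'h
  show "(\<lambda>j. (norm (if j = i then h else 0))\<^sup>2) summable_on UNIV"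
    by (rule finite_nonzero_values_imp_summable_on) (rule finite_subset[of _ "{i}"], auto)
qed

lemma ell2_nth_single: "ell2_nth (ell2_single i h) j = (if j = i then h else 0)"
  by (simp add: ell2_single.rep_eq)

lemma cinner_ell2_single_left: "cinner (ell2_single i h) x = cinner h (ell2_nth x i)"
proof -
  have "(\<Sum>\<^sub>\<infinity>j. cinner (ell2_nth (ell2_single i h) j) (ell2_nth x j))
      = (\<Sum>\<^sub>\<infinity>j\<in>{i}. cinner (ell2_nth (ell2_single i h) j) (ell2_nth x j))"
    by (rule infsum_cong_neutral) (auto simp: ell2_nth_single)
  then show ?thesis by (simp add: cinner_ell2_def ell2_nth_single)
qed

lemma norm_ell2_single: "norm (ell2_single i h) = norm h"
proof -
  have "complex_of_real ((norm (ell2_single i h))\<^sup>2) = complex_of_real ((norm h)\<^sup>2)"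
    by (simp only: cinner_norm[symmetric] cinner_ell2_single_left ell2_nth_single) simp
  then show ?thesis by (simp only: of_real_eq_iff) simp
qed

lemma has_sum_ell2_single:
  fixes x :: "('j, 'h::chilbert_space) ell2"
  shows "((\<lambda>j. ell2_single j (ell2_nth x j)) has_sum x) UNIV"
  unfolding has_sum_def tendsto_iff
proof (intro allI impI)
  fix e :: real assume e: "e > 0"
  define a where "a j = (norm (ell2_nth x j))\<^sup>2" for j
  define s where "s = (\<Sum>\<^sub>\<infinity>j. a j)"
  have sm: "a summable_on UNIV" unfolding a_def by (rule ell2_nth_summable)
  then have "(sum a \<longlongrightarrow> s) (finite_subsets_at_top UNIV)"
    unfolding s_def using has_sum_infsum has_sum_def by blast
  then have "\<forall>\<^sub>F F in finite_subsets_at_top UNIV. s - e\<^sup>2 < sum a F"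
    by (rule order_tendstoD) (use e in simp)
  moreover have "\<forall>\<^sub>F F in finite_subsets_at_top (UNIV :: 'j set). finite F"
    by (rule eventually_finite_subsets_at_top_weakI)
  ultimately show "\<forall>\<^sub>F F in finite_subsets_at_top UNIV. dist (\<Sum>j\<in>F. ell2_single j (ell2_nth x j)) x < e"
  proof eventually_elim
    case (elim F)
    have nth: "ell2_nth (x - (\<Sum>j\<in>F. ell2_single j (ell2_nth x j))) j
        = (if j \<in> F then 0 else ell2_nth x j)" for j
      using elim(2) by (simp add: ell2_nth_single)
    have "norm (x - (\<Sum>j\<in>F. ell2_single j (ell2_nth x j))) \<le> sqrt (s - sum a F)"
    proof (rule norm_ell2_leI)
      fix G :: "'j set" assume G: "finite G"
      have "(\<Sum>j\<in>G. (norm (if j \<in> F then 0 else ell2_nth x j))\<^sup>2) = (\<Sum>j\<in>G. if j \<in> F then 0 else a j)"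
        by (rule sum.cong) (auto simp: a_def)
      also have "\<dots> = sum a (G - F)"
        using G by (simp add: sum.If_cases Diff_eq)
      also have "\<dots> + sum a F = sum a ((G - F) \<union> F)"
        using G elim(2) by (intro sum.union_disjoint[symmetric]) auto
      also have "\<dots> \<le> s" unfolding s_def
        using G elim(2) by (intro finite_sum_le_infsum sm) (auto simp: a_def)
      finally have "(\<Sum>j\<in>G. (norm (if j \<in> F then 0 else ell2_nth x j))\<^sup>2) \<le> s - sum a F"
        by simp
      then show "L2_set (\<lambda>j. norm (ell2_nth (x - (\<Sum>j\<in>F. ell2_single j (ell2_nth x j))) j)) G
          \<le> sqrt (s - sum a F)"
        unfolding nth L2_set_def by (rule real_sqrt_le_mono)
    qed
    also have "\<dots> < sqrt (e\<^sup>2)" using elim(1) by (intro real_sqrt_less_mono) simp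
    also have "\<dots> = e" using e by simp
    finally show ?case by (simp add: dist_norm norm_minus_commute)
  qed
qed

section \<open>The C*-algebra of matrices defining bounded operators\<close>

definition bmat_represents ::
  "('j \<Rightarrow> 'j \<Rightarrow> 'h::chilbert_space bop) \<Rightarrow> ('j, 'h) ell2 bop \<Rightarrow> bool" where
  "bmat_represents A T \<longleftrightarrow>
    (\<forall>x i. ((\<lambda>j. bop_apply (A i j) (ell2_nth x j)) has_sum ell2_nth (bop_apply T x) i) UNIV)"

lift_definition bop_entry :: "('j, 'h::chilbert_space) ell2 bop \<Rightarrow> 'j \<Rightarrow> 'j \<Rightarrow> 'h bop"
  is "\<lambda>T i j h. ell2_nth (T (ell2_single j h)) i"
proof -
  fix T :: "('j, 'h) ell2 \<Rightarrow> ('j, 'h) ell2" and i j :: 'j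
  assume T: "bounded_clinear T"
  have single: "bounded_clinear (ell2_single j :: 'h \<Rightarrow> _)"
    unfolding bounded_clinear_def clinear_def
    by (auto intro!: exI[of _ 1] ell2_eqI simp: ell2_nth_single norm_ell2_single)
  show "bounded_clinear (\<lambda>h. ell2_nth (T (ell2_single j h)) i)"
    by (rule bounded_clinearI)
      (simp_all add: bounded_linear_compose[OF bounded_clinear_bounded_linear[OF bounded_clinear_ell2_nth]
          bounded_linear_compose[OF bounded_clinear_bounded_linear[OF T] bounded_clinear_bounded_linear[OF single]]]
        bounded_clinear_scaleC[OF single] bounded_clinear_scaleC[OF T])
qed

lemma bop_entry_represents: "bmat_represents (bop_entry T) T"
  unfolding bmat_represents_def
proof (intro allI)
  fix x i
  have "bounded_linear (\<lambda>x. ell2_nth (bop_apply T x) i)"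
    by (rule bounded_linear_compose[OF bounded_clinear_bounded_linear[OF bounded_clinear_ell2_nth]
          bounded_linear_bop_apply])
  from has_sum_bounded_linear[OF this has_sum_ell2_single[of x]]
  show "((\<lambda>j. bop_apply (bop_entry T i j) (ell2_nth x j)) has_sum ell2_nth (bop_apply T x) i) UNIV"
    by (simp add: bop_entry.rep_eq)
qed

lemma bmat_represents_single:
  assumes "bmat_represents A T"
  shows "ell2_nth (bop_apply T (ell2_single j h)) i = bop_apply (A i j) h"
proof -
  have 0: "bop_apply (A i j') 0 = 0" for j'
    using bounded_linear.linear[OF bounded_linear_bop_apply] by (rule linear_0)
  have "((\<lambda>j'. bop_apply (A i j') (ell2_nth (ell2_single j h) j')) has_sum bop_apply (A i j) h) UNIV"
    by (rule has_sum_finite_neutralI[of "{j}"]) (auto simp: ell2_nth_single 0)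
  moreover have "((\<lambda>j'. bop_apply (A i j') (ell2_nth (ell2_single j h) j')) has_sum
      ell2_nth (bop_apply T (ell2_single j h)) i) UNIV"
    using assms unfolding bmat_represents_def by blast
  ultimately show ?thesis by (rule has_sum_unique[symmetric])
qed

lemma bmat_represents_iff: "bmat_represents A T \<longleftrightarrow> A = bop_entry T"
proof
  assume "bmat_represents A T"
  then show "A = bop_entry T"
    by (intro ext bop_eqI) (simp add: bop_entry.rep_eq bmat_represents_single)
qed (simp add: bop_entry_represents)

lemma bop_entry_inject: "bop_entry S = bop_entry T \<Longrightarrow> S = T"
proof (intro bop_eqI ell2_eqI)
  fix x i assume "bop_entry S = bop_entry T"
  then show "ell2_nth (bop_apply S x) i = ell2_nth (bop_apply T x) i"
    using bop_entry_represents[of S] bop_entry_represents[of T] has_sum_unique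
    unfolding bmat_represents_def by metis
qed

text \<open>A matrix defines a bounded operator on the Hilbert sum when the matrix-vector products
  converge (unconditionally, in norm) to the components of a bounded operator.\<close>

typedef (overloaded) ('j, 'h) bmat =
  "{A :: 'j \<Rightarrow> 'j \<Rightarrow> 'h::chilbert_space bop. \<exists>T. bmat_represents A T}"
  morphisms bmat_entry Bmat
  using bop_entry_represents by blast

setup_lifting type_definition_bmat

definition bmat_op :: "('j, 'h::chilbert_space) bmat \<Rightarrow> ('j, 'h) ell2 bop" where
  "bmat_op A = (THE T. bmat_represents (bmat_entry A) T)"

definition bmat_of_op :: "('j, 'h::chilbert_space) ell2 bop \<Rightarrow> ('j, 'h) bmat" where
  "bmat_of_op T = Bmat (bop_entry T)"

lemma bmat_entry_of_op: "bmat_entry (bmat_of_op T) = bop_entry T"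
  unfolding bmat_of_op_def using bop_entry_represents by (subst Bmat_inverse) auto

lemma bmat_op_eqI: "bmat_represents (bmat_entry A) T \<Longrightarrow> bmat_op A = T"
  unfolding bmat_op_def bmat_represents_iff by (rule the_equality) (auto intro: bop_entry_inject)

lemma bmat_op_of_op [simp]: "bmat_op (bmat_of_op T) = T"
  by (rule bmat_op_eqI) (simp add: bmat_entry_of_op bop_entry_represents)

lemma bmat_represents_op: "bmat_represents (bmat_entry A) (bmat_op A)"
  using bmat_entry[of A] bmat_op_eqI[of A] by auto

lemma bmat_entry_eq: "bmat_entry A = bop_entry (bmat_op A)"
  using bmat_represents_op by (simp add: bmat_represents_iff)

lemma bmat_of_op_op [simp]: "bmat_of_op (bmat_op A) = A"
  by (simp add: bmat_entry_inject[symmetric] bmat_entry_of_op bmat_entry_eq)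

lemma bmat_eqI: "bmat_op A = bmat_op B \<Longrightarrow> A = B"
  by (metis bmat_of_op_op)

lemma cinner_bop_star: "cinner (bop_apply T x) y = cinner x (bop_apply (star T) y)"
  using someI_ex[OF adjoint_exists[of T]] unfolding star_bop_def by blast

lemma bop_entry_star: "bop_entry (star T) i j = star (bop_entry T j i)"
proof (intro bop_eqI cinner_eqI)
  fix h k
  have "cinner k (bop_apply (bop_entry (star T) i j) h)
      = cinner (ell2_single i k) (bop_apply (star T) (ell2_single j h))"
    by (simp add: bop_entry.rep_eq cinner_ell2_single_left)
  also have "\<dots> = cinner (bop_apply T (ell2_single i k)) (ell2_single j h)"
    by (simp add: cinner_bop_star)
  also have "\<dots> = cinner (bop_apply (bop_entry T j i) k) h"
    by (subst (1 2) cinner_commute) (simp add: bop_entry.rep_eq cinner_ell2_single_left)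
  finally show "cinner k (bop_apply (bop_entry (star T) i j) h)
      = cinner k (bop_apply (star (bop_entry T j i)) h)"
    by (simp add: cinner_bop_star)
qed

instantiation bmat :: (type, chilbert_space) "{complex_normed_vector, real_normed_algebra}"
begin

lift_definition zero_bmat :: "('a, 'b) bmat" is "\<lambda>i j. 0"
proof -
  have "(\<lambda>i j. 0) = bop_entry (0 :: ('a, 'b) ell2 bop)"
    by (intro ext bop_eqI) (simp add: bop_entry.rep_eq zero_bop.rep_eq)
  then show "\<exists>T :: ('a, 'b) ell2 bop. bmat_represents (\<lambda>i j. 0) T"
    unfolding bmat_represents_iff by blast
qed

lift_definition plus_bmat :: "('a, 'b) bmat \<Rightarrow> ('a, 'b) bmat \<Rightarrow> ('a, 'b) bmat"
  is "\<lambda>A B i j. A i j + B i j"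
proof -
  fix A B :: "'a \<Rightarrow> 'a \<Rightarrow> 'b bop"
  assume "\<exists>T. bmat_represents A T" "\<exists>T. bmat_represents B T"
  then obtain S T where "A = bop_entry S" "B = bop_entry T" unfolding bmat_represents_iff by blast
  then have "(\<lambda>i j. A i j + B i j) = bop_entry (S + T)"
    by (intro ext bop_eqI) (simp add: bop_entry.rep_eq plus_bop.rep_eq)
  then show "\<exists>T. bmat_represents (\<lambda>i j. A i j + B i j) T" unfolding bmat_represents_iff by blast
qed

lift_definition uminus_bmat :: "('a, 'b) bmat \<Rightarrow> ('a, 'b) bmat" is "\<lambda>A i j. - A i j"
proof -
  fix A :: "'a \<Rightarrow> 'a \<Rightarrow> 'b bop"
  assume "\<exists>T. bmat_represents A T"
  then obtain S where "A = bop_entry S" unfolding bmat_represents_iff by blast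
  then have "(\<lambda>i j. - A i j) = bop_entry (- S)"
    by (intro ext bop_eqI) (simp add: bop_entry.rep_eq uminus_bop.rep_eq uminus_ell2.rep_eq)
  then show "\<exists>T. bmat_represents (\<lambda>i j. - A i j) T" unfolding bmat_represents_iff by blast
qed

lift_definition minus_bmat :: "('a, 'b) bmat \<Rightarrow> ('a, 'b) bmat \<Rightarrow> ('a, 'b) bmat"
  is "\<lambda>A B i j. A i j - B i j"
proof -
  fix A B :: "'a \<Rightarrow> 'a \<Rightarrow> 'b bop"
  assume "\<exists>T. bmat_represents A T" "\<exists>T. bmat_represents B T"
  then obtain S T where "A = bop_entry S" "B = bop_entry T" unfolding bmat_represents_iff by blast
  then have "(\<lambda>i j. A i j - B i j) = bop_entry (S - T)"
    by (intro ext bop_eqI) (simp add: bop_entry.rep_eq minus_bop.rep_eq)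
  then show "\<exists>T. bmat_represents (\<lambda>i j. A i j - B i j) T" unfolding bmat_represents_iff by blast
qed

lift_definition scaleC_bmat :: "complex \<Rightarrow> ('a, 'b) bmat \<Rightarrow> ('a, 'b) bmat" is "\<lambda>c A i j. c *\<^sub>C A i j"
proof -
  fix A :: "'a \<Rightarrow> 'a \<Rightarrow> 'b bop" and c
  assume "\<exists>T. bmat_represents A T"
  then obtain S where "A = bop_entry S" unfolding bmat_represents_iff by blast
  then have "(\<lambda>i j. c *\<^sub>C A i j) = bop_entry (c *\<^sub>C S)"
    by (intro ext bop_eqI) (simp add: bop_entry.rep_eq scaleC_bop.rep_eq)
  then show "\<exists>T. bmat_represents (\<lambda>i j. c *\<^sub>C A i j) T" unfolding bmat_represents_iff by blast
qed

definition scaleR_bmat :: "real \<Rightarrow> ('a, 'b) bmat \<Rightarrow> ('a, 'b) bmat" where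
  "scaleR_bmat r A = complex_of_real r *\<^sub>C A"

definition times_bmat :: "('a, 'b) bmat \<Rightarrow> ('a, 'b) bmat \<Rightarrow> ('a, 'b) bmat" where
  "times_bmat A B = bmat_of_op (bmat_op A * bmat_op B)"

definition norm_bmat :: "('a, 'b) bmat \<Rightarrow> real" where
  "norm_bmat A = norm (bmat_op A)"

definition dist_bmat :: "('a, 'b) bmat \<Rightarrow> ('a, 'b) bmat \<Rightarrow> real" where
  "dist_bmat A B = norm (A - B)"

definition uniformity_bmat :: "(('a, 'b) bmat \<times> ('a, 'b) bmat) filter" where
  "uniformity_bmat = (INF e\<in>{0<..}. principal {(x, y). dist x y < e})"

definition open_bmat :: "('a, 'b) bmat set \<Rightarrow> bool" where
  "open_bmat S = (\<forall>x\<in>S. \<forall>\<^sub>F (x', y) in uniformity. x' = x \<longrightarrow> y \<in> S)"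

definition sgn_bmat :: "('a, 'b) bmat \<Rightarrow> ('a, 'b) bmat" where
  "sgn_bmat x = scaleR (inverse (norm x)) x"

lemma bmat_op_zero: "bmat_op (0 :: ('a, 'b) bmat) = 0"
  by (rule bmat_op_eqI, unfold bmat_represents_iff zero_bmat.rep_eq, intro ext bop_eqI)
    (simp add: bop_entry.rep_eq zero_bop.rep_eq)

lemma bmat_op_add: "bmat_op (A + B :: ('a, 'b) bmat) = bmat_op A + bmat_op B"
  by (rule bmat_op_eqI, unfold bmat_represents_iff plus_bmat.rep_eq, intro ext bop_eqI)
    (simp add: bmat_entry_eq bop_entry.rep_eq plus_bop.rep_eq)

lemma bmat_op_uminus: "bmat_op (- A :: ('a, 'b) bmat) = - bmat_op A"
  by (rule bmat_op_eqI, unfold bmat_represents_iff uminus_bmat.rep_eq, intro ext bop_eqI)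
    (simp add: bmat_entry_eq bop_entry.rep_eq uminus_bop.rep_eq uminus_ell2.rep_eq)

lemma bmat_op_diff: "bmat_op (A - B :: ('a, 'b) bmat) = bmat_op A - bmat_op B"
  by (rule bmat_op_eqI, unfold bmat_represents_iff minus_bmat.rep_eq, intro ext bop_eqI)
    (simp add: bmat_entry_eq bop_entry.rep_eq minus_bop.rep_eq)

lemma bmat_op_scaleC: "bmat_op (c *\<^sub>C A :: ('a, 'b) bmat) = c *\<^sub>C bmat_op A"
  by (rule bmat_op_eqI, unfold bmat_represents_iff scaleC_bmat.rep_eq, intro ext bop_eqI)
    (simp add: bmat_entry_eq bop_entry.rep_eq scaleC_bop.rep_eq)

lemma bmat_op_scaleR: "bmat_op (r *\<^sub>R A :: ('a, 'b) bmat) = r *\<^sub>R bmat_op A"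
  unfolding scaleR_bmat_def scaleR_bop_def by (rule bmat_op_scaleC)

lemma bmat_op_mult: "bmat_op (A * B :: ('a, 'b) bmat) = bmat_op A * bmat_op B"
  by (simp add: times_bmat_def)

instance
proof
  note ops = bmat_op_zero bmat_op_add bmat_op_uminus bmat_op_diff bmat_op_scaleC bmat_op_scaleR bmat_op_mult
  fix x y z :: "('a, 'b) bmat" and r s :: real and u v :: complex
  show "x + y + z = x + (y + z)" "x + y = y + x" "0 + x = x" "- x + x = 0" "x - y = x + - y"
    by (rule bmat_eqI, simp add: ops ac_simps)+
  show "r *\<^sub>R (x + y) = r *\<^sub>R x + r *\<^sub>R y" "(r + s) *\<^sub>R x = r *\<^sub>R x + s *\<^sub>R x"
    "r *\<^sub>R s *\<^sub>R x = (r * s) *\<^sub>R x" "1 *\<^sub>R x = x"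
    by (rule bmat_eqI, simp add: ops scaleR_add_right scaleR_add_left)+
  show "dist x y = norm (x - y)" by (rule dist_bmat_def)
  show "sgn x = inverse (norm x) *\<^sub>R x" by (rule sgn_bmat_def)
  show "(uniformity :: (('a, 'b) bmat \<times> ('a, 'b) bmat) filter) = (INF e\<in>{0<..}. principal {(x, y). dist x y < e})"
    by (rule uniformity_bmat_def)
  show "open U = (\<forall>x\<in>U. \<forall>\<^sub>F (x', y) in uniformity. x' = x \<longrightarrow> y \<in> U)" for U :: "('a, 'b) bmat set"
    by (rule open_bmat_def)
  show "(norm x = 0) = (x = 0)"
    unfolding norm_bmat_def norm_eq_zero using bmat_eqI[of x 0] by (auto simp: bmat_op_zero)
  show "norm (x + y) \<le> norm x + norm y"
    unfolding norm_bmat_def bmat_op_add by (rule norm_triangle_ineq)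
  show "norm (r *\<^sub>R x) = \<bar>r\<bar> * norm x" by (simp add: norm_bmat_def bmat_op_scaleR)
  show "u *\<^sub>C (x + y) = u *\<^sub>C x + u *\<^sub>C y" "(u + v) *\<^sub>C x = u *\<^sub>C x + v *\<^sub>C x"
    "u *\<^sub>C v *\<^sub>C x = (u * v) *\<^sub>C x"
    by (rule bmat_eqI, simp add: ops scaleC_add_right scaleC_add_left scaleC_scaleC)+
  show "complex_of_real r *\<^sub>C x = r *\<^sub>R x" by (simp add: scaleR_bmat_def)
  show "norm (u *\<^sub>C x) = cmod u * norm x"
    by (simp add: norm_bmat_def bmat_op_scaleC norm_scaleC)
  show "x * y * z = x * (y * z)" "(x + y) * z = x * z + y * z" "x * (y + z) = x * y + x * z"
    "r *\<^sub>R x * y = r *\<^sub>R (x * y)" "x * r *\<^sub>R y = r *\<^sub>R (x * y)"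
    by (rule bmat_eqI, simp add: ops mult.assoc distrib_left distrib_right)+
  show "norm (x * y) \<le> norm x * norm y"
    unfolding norm_bmat_def bmat_op_mult by (rule norm_mult_ineq)
qed

end

instance bmat :: (type, chilbert_space) banach
proof
  fix X :: "nat \<Rightarrow> ('a, 'b) bmat"
  assume X: "Cauchy X"
  have "dist (bmat_op x) (bmat_op y) = dist x y" for x y :: "('a, 'b) bmat"
    by (simp add: dist_norm norm_bmat_def bmat_op_diff)
  note dist = this
  from X have "Cauchy (\<lambda>n. bmat_op (X n))" by (simp add: Cauchy_def dist)
  then obtain L where "(\<lambda>n. bmat_op (X n)) \<longlonglongrightarrow> L" using Cauchy_convergent convergent_def by blast
  then have "X \<longlonglongrightarrow> bmat_of_op L"
    unfolding lim_sequentially by (simp add: dist[symmetric])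
  then show "convergent X" by (rule convergentI)
qed

instantiation bmat :: (type, chilbert_space) cstar_algebra
begin

lift_definition star_bmat :: "('a, 'b) bmat \<Rightarrow> ('a, 'b) bmat" is "\<lambda>A i j. star (A j i)"
proof -
  fix A :: "'a \<Rightarrow> 'a \<Rightarrow> 'b bop"
  assume "\<exists>T. bmat_represents A T"
  then obtain S where "A = bop_entry S" unfolding bmat_represents_iff by blast
  then have "(\<lambda>i j. star (A j i)) = bop_entry (star S)"
    by (intro ext) (simp add: bop_entry_star)
  then show "\<exists>T. bmat_represents (\<lambda>i j. star (A j i)) T" unfolding bmat_represents_iff by blast
qed

lemma bmat_op_star: "bmat_op (star A :: ('a, 'b) bmat) = star (bmat_op A)"
  by (rule bmat_op_eqI, unfold bmat_represents_iff star_bmat.rep_eq, intro ext)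
    (simp add: bmat_entry_eq bop_entry_star)

instance
proof
  note ops = bmat_op_add bmat_op_scaleC bmat_op_mult bmat_op_star
  fix x y :: "('a, 'b) bmat" and u :: complex
  show "u *\<^sub>C x * y = u *\<^sub>C (x * y)" "x * u *\<^sub>C y = u *\<^sub>C (x * y)"
    "star (star x) = x" "star (x + y) = star x + star y"
    "star (u *\<^sub>C x) = cnj u *\<^sub>C star x" "star (x * y) = star y * star x"
    by (rule bmat_eqI, simp add: ops scaleC_mult_left scaleC_mult_right star_star star_add star_scaleC star_mult)+
  show "norm (star x * x) = (norm x)\<^sup>2"
    by (simp add: norm_bmat_def ops norm_star_mult_self)
qed

end

text \<open>The product of \<^type>\<open>bmat\<close>, defined through operators, is matrix multiplication.\<close>

lemma bmat_entry_mult: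
  "((\<lambda>k. bop_apply (bmat_entry A i k) (bop_apply (bmat_entry B k j) h)) has_sum
    bop_apply (bmat_entry (A * B) i j) h) UNIV"
proof -
  have "ell2_nth (bop_apply (bmat_op B) (ell2_single j h)) k = bop_apply (bmat_entry B k j) h" for k
    by (rule bmat_represents_single[OF bmat_represents_op])
  moreover have "ell2_nth (bop_apply (bmat_op A) (bop_apply (bmat_op B) (ell2_single j h))) i
      = bop_apply (bmat_entry (A * B) i j) h"
    using bmat_represents_single[OF bmat_represents_op, of "A * B" j h i]
    by (simp add: bmat_op_mult times_bop.rep_eq)
  moreover have "((\<lambda>k. bop_apply (bmat_entry A i k) (ell2_nth (bop_apply (bmat_op B) (ell2_single j h)) k)) has_sum
      ell2_nth (bop_apply (bmat_op A) (bop_apply (bmat_op B) (ell2_single j h))) i) UNIV"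
    using bmat_represents_op[of A] unfolding bmat_represents_def by blast
  ultimately show ?thesis by (simp only:)
qed

text \<open>Since \<open>Bmat\<close> is unspecified outside the bounded matrices, the equation
  \<open>bmat_entry (A \<box> B) i j = bmat_entry A i j * bmat_entry B i j\<close> is a genuine claim: it says that
  the entrywise product again defines a bounded operator.\<close>

definition schur_product ::
  "('j, 'h::chilbert_space) bmat \<Rightarrow> ('j, 'h) bmat \<Rightarrow> ('j, 'h) bmat" (infixl "\<box>" 70) where
  "A \<box> B = Bmat (\<lambda>i j. bmat_entry A i j * bmat_entry B i j)"


section \<open>Matrices over a C*-algebra and complete boundedness\<close>

definition mat_star :: "'a::cstar_algebra mat \<Rightarrow> 'a mat" where
  "mat_star X = mat (dim_col X) (dim_row X) (\<lambda>(i, j). star (X $$ (j, i)))"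

definition mat_elem :: "nat \<Rightarrow> nat \<Rightarrow> nat \<Rightarrow> 'a::cstar_algebra \<Rightarrow> 'a mat" where
  "mat_elem k i j a = mat k k (\<lambda>(p, q). if p = i \<and> q = j then a else 0)"

text \<open>C*-norms on the *-algebra of \<open>k \<times> k\<close> matrices over a C*-algebra. Such a norm is unique,
  and automatically complete and isometric on each diagonal corner; the last clause records the
  latter property, so that uniqueness has the elementary proof \<open>mat_cstar_norm_unique\<close> below.\<close>

definition is_mat_cstar_norm :: "nat \<Rightarrow> ('a::cstar_algebra mat \<Rightarrow> real) \<Rightarrow> bool" where
  "is_mat_cstar_norm k N \<longleftrightarrow>
    (\<forall>X\<in>carrier_mat k k. 0 \<le> N X \<and> (N X = 0 \<longleftrightarrow> X = 0\<^sub>m k k)) \<and>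
    (\<forall>X\<in>carrier_mat k k. \<forall>c. N (map_mat (\<lambda>a. c *\<^sub>C a) X) = cmod c * N X) \<and>
    (\<forall>X\<in>carrier_mat k k. \<forall>Y\<in>carrier_mat k k. N (X + Y) \<le> N X + N Y) \<and>
    (\<forall>X\<in>carrier_mat k k. \<forall>Y\<in>carrier_mat k k. N (X * Y) \<le> N X * N Y) \<and>
    (\<forall>X\<in>carrier_mat k k. N (mat_star X * X) = (N X)\<^sup>2) \<and>
    (\<forall>i<k. \<forall>a. N (mat_elem k i i a) = norm a)"

definition mat_cstar_norm :: "nat \<Rightarrow> 'a::cstar_algebra mat \<Rightarrow> real" where
  "mat_cstar_norm k X = (THE r. \<exists>N. is_mat_cstar_norm k N \<and> N X = r)"

definition amplification ::
  "('a::cstar_algebra \<Rightarrow> 'b::cstar_algebra \<Rightarrow> 'c::cstar_algebra) \<Rightarrow> nat \<Rightarrow> 'a mat \<Rightarrow> 'b mat \<Rightarrow> 'c mat" where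
  "amplification \<Phi> k A B = mat k k (\<lambda>(i, j). \<Sum>l<k. \<Phi> (A $$ (i, l)) (B $$ (l, j)))"

text \<open>Norms of bilinear maps are taken in the extended reals, so that the suprema below
  are meaningful for unbounded maps as well.\<close>

definition amplification_norm ::
  "('a::cstar_algebra \<Rightarrow> 'b::cstar_algebra \<Rightarrow> 'c::cstar_algebra) \<Rightarrow> nat \<Rightarrow> ereal" where
  "amplification_norm \<Phi> k =
    (SUP (A, B) \<in> {(A, B). A \<in> carrier_mat k k \<and> B \<in> carrier_mat k k \<and>
        mat_cstar_norm k A \<le> 1 \<and> mat_cstar_norm k B \<le> 1}.
      ereal (mat_cstar_norm k (amplification \<Phi> k A B)))"

definition completely_bounded ::
  "('a::cstar_algebra \<Rightarrow> 'b::cstar_algebra \<Rightarrow> 'c::cstar_algebra) \<Rightarrow> bool" where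
  "completely_bounded \<Phi> \<longleftrightarrow> (\<exists>K::real. \<forall>k\<ge>1. amplification_norm \<Phi> k \<le> ereal K)"

definition cb_norm :: "('a::cstar_algebra \<Rightarrow> 'b::cstar_algebra \<Rightarrow> 'c::cstar_algebra) \<Rightarrow> ereal" where
  "cb_norm \<Phi> = (SUP k\<in>{1..}. amplification_norm \<Phi> k)"

lemma star_zero [simp]: "star (0::'a::cstar_algebra) = 0"
  using star_add[of "0::'a" 0] by simp

lemma norm_star [simp]: "norm (star (a::'a::cstar_algebra)) = norm a"
proof -
  have le: "norm (b::'a) \<le> norm (star b)" for b
  proof (cases "norm b = 0")
    case False
    have "norm b * norm b \<le> norm (star b) * norm b"
      using norm_mult_ineq[of "star b" b] by (simp add: norm_star_mult_self power2_eq_square)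
    then show ?thesis using False by (simp add: mult_le_cancel_right)
  qed simp
  show ?thesis using le[of a] le[of "star a"] by (simp add: star_star)
qed

lemma norm_cube_le: "(norm a) ^ 3 \<le> norm (star a * a * star (a::'a::cstar_algebra))"
proof (cases "norm a = 0")
  case False
  define h where "h = star a * a"
  have sh: "star h = h" by (simp add: h_def star_mult star_star)
  have sh2: "star (h * h) = h * h" by (simp add: star_mult sh)
  have h: "norm h = (norm a)\<^sup>2" by (simp add: h_def norm_star_mult_self)
  have "norm ((h * h) * (h * h)) = (norm (h * h))\<^sup>2" using norm_star_mult_self[of "h * h"] by (simp only: sh2)
  also have "norm (h * h) = (norm h)\<^sup>2" using norm_star_mult_self[of h] by (simp only: sh)
  finally have "norm h ^ 4 = norm ((h * h) * (h * h))" by (simp add: power_mult[symmetric])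
  also have "\<dots> = norm ((h * h * h) * h)" by (simp add: mult.assoc)
  also have "\<dots> \<le> norm (h * h * h) * norm h" by (rule norm_mult_ineq)
  finally have "norm h * norm h ^ 3 \<le> norm h * norm (h * h * h)"
    by (simp add: power4_eq_xxxx power3_eq_cube ac_simps)
  moreover have "norm h > 0" using False by (simp add: h)
  ultimately have 1: "norm h ^ 3 \<le> norm (h * h * h)" by (simp add: mult_le_cancel_left_pos)
  have "h * h * h = (h * star a) * star (h * star a)"
    by (simp add: star_mult star_star sh) (simp add: h_def mult.assoc)
  also have "norm \<dots> = (norm (h * star a))\<^sup>2"
    using norm_star_mult_self[of "star (h * star a)"] by (simp only: star_star norm_star)
  finally have "(norm a ^ 3)\<^sup>2 \<le> (norm (h * star a))\<^sup>2"
    using 1 by (simp add: h power_mult[symmetric])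
  then show ?thesis unfolding h_def by (rule power2_le_imp_le) simp
qed simp

lemma mat_mult_index:
  "X \<in> carrier_mat k k \<Longrightarrow> Y \<in> carrier_mat k k \<Longrightarrow> i < k \<Longrightarrow> j < k \<Longrightarrow>
    (X * Y) $$ (i, j) = (\<Sum>l<k. X $$ (i, l) * Y $$ (l, j))"
  by (simp add: scalar_prod_def atLeast0LessThan)

lemma mat_elem_carrier [simp]: "mat_elem k i j a \<in> carrier_mat k k"
  by (simp add: mat_elem_def)

lemma mat_star_carrier: "X \<in> carrier_mat k k \<Longrightarrow> mat_star X \<in> carrier_mat k k"
  by (simp add: mat_star_def)

lemma mat_elem_mult:
  assumes X: "X \<in> carrier_mat k k" and p: "p < k" and ij: "i < k" "j < k"
  shows "(mat_elem k i p a * X) $$ (q, j) = (if q < k then (if q = i then a * X $$ (p, j) else 0) else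
      (mat_elem k i p a * X) $$ (q, j))"
proof (cases "q < k")
  case True
  have "(mat_elem k i p a * X) $$ (q, j) = (\<Sum>l<k. mat_elem k i p a $$ (q, l) * X $$ (l, j))"
    by (rule mat_mult_index) (use X ij True in auto)
  also have "\<dots> = (\<Sum>l<k. if l = p then (if q = i then a * X $$ (p, j) else 0) else 0)"
    by (rule sum.cong) (use True in \<open>auto simp: mat_elem_def\<close>)
  also have "\<dots> = (if q = i then a * X $$ (p, j) else 0)" using p by simp
  finally show ?thesis using True by simp
qed simp

lemma mat_elem_sandwich:
  assumes X: "X \<in> carrier_mat k k" and ij: "i < k" "j < k"
  shows "mat_elem k i i a * X * mat_elem k j j b = mat_elem k i j (a * X $$ (i, j) * b)"
proof (rule eq_matI)
  fix p q assume "p < dim_row (mat_elem k i j (a * X $$ (i, j) * b))"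
    and "q < dim_col (mat_elem k i j (a * X $$ (i, j) * b))"
  then have pq: "p < k" "q < k" by (simp_all add: mat_elem_def)
  have "(mat_elem k i i a * X * mat_elem k j j b) $$ (p, q)
      = (\<Sum>l<k. (mat_elem k i i a * X) $$ (p, l) * mat_elem k j j b $$ (l, q))"
    by (rule mat_mult_index) (use X pq mult_carrier_mat[OF mat_elem_carrier X] in auto)
  also have "\<dots> = (\<Sum>l<k. if l = j then (if p = i \<and> q = j then a * X $$ (i, j) * b else 0) else 0)"
  proof (rule sum.cong)
    fix l assume "l \<in> {..<k}"
    then show "(mat_elem k i i a * X) $$ (p, l) * mat_elem k j j b $$ (l, q)
        = (if l = j then (if p = i \<and> q = j then a * X $$ (i, j) * b else 0) else 0)"
      using mat_elem_mult[OF X ij(1) ij(1), of l a p] pq by (simp add: mat_elem_def)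
  qed simp
  also have "\<dots> = mat_elem k i j (a * X $$ (i, j) * b) $$ (p, q)"
    using pq ij by (simp add: mat_elem_def)
  finally show "(mat_elem k i i a * X * mat_elem k j j b) $$ (p, q)
      = mat_elem k i j (a * X $$ (i, j) * b) $$ (p, q)" .
qed (use X in \<open>simp_all add: mat_elem_def\<close>)

lemma mat_elem_star_mult:
  assumes ij: "i < k" "j < k"
  shows "mat_star (mat_elem k i j a) * mat_elem k i j a = mat_elem k j j (star a * a)"
proof -
  have st: "mat_star (mat_elem k i j a) = mat_elem k j i (star a)"
    by (rule eq_matI) (auto simp: mat_star_def mat_elem_def)
  show ?thesis unfolding st
  proof (rule eq_matI)
    fix p q assume "p < dim_row (mat_elem k j j (star a * a))" "q < dim_col (mat_elem k j j (star a * a))"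
    then have pq: "p < k" "q < k" by (simp_all add: mat_elem_def)
    show "(mat_elem k j i (star a) * mat_elem k i j a) $$ (p, q) = mat_elem k j j (star a * a) $$ (p, q)"
      using mat_elem_mult[OF mat_elem_carrier[of k i j a] ij(1) ij(2) pq(2), of "star a" p] pq ij
      by (auto simp: mat_elem_def split: if_splits)
  qed (simp_all add: mat_elem_def)
qed

context
  fixes k :: nat and N :: "'a::cstar_algebra mat \<Rightarrow> real"
  assumes N: "is_mat_cstar_norm k N"
begin

lemma mat_norm_elem:
  assumes "i < k" "j < k"
  shows "N (mat_elem k i j a) = norm a"
proof -
  have "(N (mat_elem k i j a))\<^sup>2 = N (mat_elem k j j (star a * a))"
    using N mat_elem_carrier unfolding is_mat_cstar_norm_def mat_elem_star_mult[OF assms, symmetric] by metis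
  also have "\<dots> = (norm a)\<^sup>2"
    using N assms unfolding is_mat_cstar_norm_def by (simp add: norm_star_mult_self)
  finally show ?thesis
    using N mat_elem_carrier[of k i j a] unfolding is_mat_cstar_norm_def
    by (metis norm_ge_zero power2_eq_imp_eq)
qed

lemma norm_index_le_mat_norm:
  assumes X: "X \<in> carrier_mat k k" and ij: "i < k" "j < k"
  shows "norm (X $$ (i, j)) \<le> N X"
proof (cases "norm (X $$ (i, j)) = 0")
  case True
  then show ?thesis using N X unfolding is_mat_cstar_norm_def by simp
next
  case False
  define x where "x = X $$ (i, j)"
  have c: "mat_elem k i i (star x) * X \<in> carrier_mat k k"
    by (rule mult_carrier_mat[OF mat_elem_carrier X])
  have sub: "N (Y * Z) \<le> N Y * N Z" if "Y \<in> carrier_mat k k" "Z \<in> carrier_mat k k" for Y Z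
    using N that unfolding is_mat_cstar_norm_def by blast
  have "(norm x) ^ 3 \<le> norm (star x * x * star x)" by (rule norm_cube_le)
  also have "\<dots> = N (mat_elem k i i (star x) * X * mat_elem k j j (star x))"
    unfolding mat_elem_sandwich[OF X ij] x_def by (rule mat_norm_elem[OF ij, symmetric])
  also have "\<dots> \<le> N (mat_elem k i i (star x) * X) * norm x"
    using sub[OF c mat_elem_carrier[of k j j "star x"]] by (simp add: mat_norm_elem ij)
  also have "\<dots> \<le> norm x * N X * norm x"
    using sub[OF mat_elem_carrier[of k i i "star x"] X]
    by (intro mult_right_mono) (simp_all add: mat_norm_elem ij)
  finally have "(norm x)\<^sup>2 * norm x \<le> (norm x)\<^sup>2 * N X"
    by (simp add: power2_eq_square power3_eq_cube ac_simps)
  moreover have "(norm x)\<^sup>2 > 0" using False by (simp add: x_def)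
  ultimately show ?thesis unfolding x_def by (simp only: mult_le_cancel_left_pos)
qed

lemma mat_norm_le_sum:
  assumes X: "X \<in> carrier_mat k k"
  shows "N X \<le> (\<Sum>(i, j)\<in>{..<k} \<times> {..<k}. norm (X $$ (i, j)))"
proof -
  define R where "R S = mat k k (\<lambda>p. if p \<in> S then X $$ p else 0)" for S
  have "S \<subseteq> {..<k} \<times> {..<k} \<Longrightarrow> N (R S) \<le> (\<Sum>(i, j)\<in>S. norm (X $$ (i, j)))" if "finite S" for S
    using that
  proof induction
    case empty
    have "R {} = 0\<^sub>m k k" by (rule eq_matI) (auto simp: R_def)
    moreover have "N (0\<^sub>m k k) = 0" using N unfolding is_mat_cstar_norm_def by auto
    ultimately show ?case by simp
  next
    case (insert p S)
    obtain i j where p: "p = (i, j)" "i < k" "j < k" using insert.prems by auto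
    have "R (insert p S) = mat_elem k i j (X $$ (i, j)) + R S"
      by (rule eq_matI) (use insert.hyps p in \<open>auto simp: R_def mat_elem_def\<close>)
    also have "N \<dots> \<le> N (mat_elem k i j (X $$ (i, j))) + N (R S)"
      using N mat_elem_carrier[of k i j "X $$ (i, j)"] unfolding is_mat_cstar_norm_def R_def by simp
    also have "\<dots> \<le> norm (X $$ (i, j)) + (\<Sum>(i, j)\<in>S. norm (X $$ (i, j)))"
      using insert p by (simp add: mat_norm_elem)
    finally show ?case using insert.hyps p by simp
  qed
  from this[of "{..<k} \<times> {..<k}"] have "N (R ({..<k} \<times> {..<k})) \<le> (\<Sum>(i, j)\<in>{..<k} \<times> {..<k}. norm (X $$ (i, j)))"
    by simp
  moreover have "R ({..<k} \<times> {..<k}) = X" by (rule eq_matI) (use X in \<open>auto simp: R_def\<close>)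
  ultimately show ?thesis by simp
qed

lemma mat_norm_iterated_square:
  assumes H: "H \<in> carrier_mat k k" "mat_star H = H"
  shows "((\<lambda>Z. Z * Z) ^^ n) H \<in> carrier_mat k k \<and> mat_star (((\<lambda>Z. Z * Z) ^^ n) H) = ((\<lambda>Z. Z * Z) ^^ n) H
    \<and> N (((\<lambda>Z. Z * Z) ^^ n) H) = N H ^ (2 ^ n)"
proof (induction n)
  case 0
  then show ?case using H by simp
next
  case (Suc n)
  define Z where "Z = ((\<lambda>Z. Z * Z) ^^ n) H"
  have Z: "Z \<in> carrier_mat k k" "mat_star Z = Z" "N Z = N H ^ (2 ^ n)" using Suc by (simp_all add: Z_def)
  have idx: "star (Z $$ (j, i)) = Z $$ (i, j)" if "i < k" "j < k" for i j
    using arg_cong[OF Z(2), of "\<lambda>M. M $$ (i, j)"] Z(1) that by (simp add: mat_star_def)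
  have ss: "star (sum f S) = (\<Sum>s\<in>S. star (f s :: 'a))" for f and S :: "nat set"
    by (induction S rule: infinite_finite_induct) (auto simp: star_add)
  have ZZ: "Z * Z \<in> carrier_mat k k" by (rule mult_carrier_mat[OF Z(1) Z(1)])
  have "mat_star (Z * Z) = Z * Z"
  proof (rule eq_matI)
    fix i j assume "i < dim_row (Z * Z)" "j < dim_col (Z * Z)"
    then have ij: "i < k" "j < k" using ZZ by auto
    have "mat_star (Z * Z) $$ (i, j) = star ((Z * Z) $$ (j, i))"
      using ZZ ij by (simp add: mat_star_def del: index_mult_mat)
    also have "\<dots> = (\<Sum>l<k. star (Z $$ (l, i)) * star (Z $$ (j, l)))"
      by (simp only: mat_mult_index[OF Z(1) Z(1) ij(2) ij(1)] ss star_mult)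
    also have "\<dots> = (\<Sum>l<k. Z $$ (i, l) * Z $$ (l, j))"
      by (rule sum.cong) (use idx ij in auto)
    also have "\<dots> = (Z * Z) $$ (i, j)" by (rule mat_mult_index[OF Z(1) Z(1) ij, symmetric])
    finally show "mat_star (Z * Z) $$ (i, j) = (Z * Z) $$ (i, j)" .
  qed (use ZZ Z(1) in \<open>simp_all add: mat_star_def\<close>)
  moreover have "N (Z * Z) = (N Z)\<^sup>2"
    using N Z(1) unfolding is_mat_cstar_norm_def by (metis Z(2))
  then have "N (Z * Z) = N H ^ (2 ^ Suc n)" by (simp add: Z(3) power_mult[symmetric] mult.commute)
  ultimately show ?case using ZZ by (simp add: Z_def)
qed

end

lemma mat_cstar_norm_le:
  fixes M N :: "'a::cstar_algebra mat \<Rightarrow> real"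
  assumes M: "is_mat_cstar_norm k M" and N: "is_mat_cstar_norm k N" and X: "X \<in> carrier_mat k k"
  shows "M X \<le> N X"
proof -
  define H where "H = mat_star X * X"
  have sX: "mat_star X \<in> carrier_mat k k" by (rule mat_star_carrier[OF X])
  have H: "H \<in> carrier_mat k k" unfolding H_def by (rule mult_carrier_mat[OF sX X])
  have ss: "star (sum f S) = (\<Sum>s\<in>S. star (f s :: 'a))" for f and S :: "nat set"
    by (induction S rule: infinite_finite_induct) (auto simp: star_add)
  have idx: "H $$ (i, j) = (\<Sum>l<k. star (X $$ (l, i)) * X $$ (l, j))" if "i < k" "j < k" for i j
    unfolding H_def mat_mult_index[OF sX X that]
    by (rule sum.cong) (use X that in \<open>auto simp: mat_star_def\<close>)
  have sH: "mat_star H = H"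
  proof (rule eq_matI)
    fix i j assume "i < dim_row H" "j < dim_col H"
    then have ij: "i < k" "j < k" using H by auto
    have "mat_star H $$ (i, j) = star (H $$ (j, i))"
      using H ij by (simp add: mat_star_def)
    also have "\<dots> = H $$ (i, j)"
      by (simp only: idx[OF ij] idx[OF ij(2) ij(1)] ss star_mult star_star)
    finally show "mat_star H $$ (i, j) = H $$ (i, j)" .
  qed (use H in \<open>simp_all add: mat_star_def\<close>)
  have le: "M Y \<le> real (k * k) * N Y" if Y: "Y \<in> carrier_mat k k" for Y
  proof -
    have "M Y \<le> (\<Sum>(i, j)\<in>{..<k} \<times> {..<k}. norm (Y $$ (i, j)))" by (rule mat_norm_le_sum[OF M Y])
    also have "\<dots> \<le> (\<Sum>(i, j)\<in>{..<k} \<times> {..<k}. N Y)"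
      by (rule sum_mono) (auto intro: norm_index_le_mat_norm[OF N Y])
    finally show ?thesis by (simp add: card_cartesian_product case_prod_unfold)
  qed
  have nn: "0 \<le> M Y" "0 \<le> N Y" if "Y \<in> carrier_mat k k" for Y
    using M N that unfolding is_mat_cstar_norm_def by blast+
  have "M H \<le> N H"
  proof (rule ccontr)
    assume "\<not> M H \<le> N H"
    then have lt: "N H < M H" by simp
    have pos: "N H > 0"
    proof (rule ccontr)
      assume "\<not> N H > 0"
      then have "N H = 0" using nn(2)[OF H] by simp
      then have "H = 0\<^sub>m k k" using N H unfolding is_mat_cstar_norm_def by blast
      then have "M H = 0" using M H unfolding is_mat_cstar_norm_def by blast
      then show False using lt \<open>N H = 0\<close> by simp
    qed
    define r where "r = M H / N H"
    have r: "r > 1" using lt pos by (simp add: r_def)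
    obtain n where n: "real (k * k) < r ^ n" using real_arch_pow[OF r] by blast
    have "M H ^ (2 ^ n) \<le> real (k * k) * N H ^ (2 ^ n)"
      using le mat_norm_iterated_square[OF M H sH, of n] mat_norm_iterated_square[OF N H sH, of n] by metis
    then have "r ^ (2 ^ n) \<le> real (k * k)"
      using pos by (simp add: r_def power_divide divide_le_eq)
    moreover have "r ^ n \<le> r ^ (2 ^ n)"
      by (rule power_increasing) (use r in \<open>auto intro: less_imp_le\<close>)
    ultimately show False using n by linarith
  qed
  then have "(M X)\<^sup>2 \<le> (N X)\<^sup>2"
    using M N X unfolding H_def is_mat_cstar_norm_def by simp
  then show ?thesis by (rule power2_le_imp_le) (rule nn(2)[OF X])
qed

lemma mat_cstar_norm_unique:
  assumes "is_mat_cstar_norm k M" "is_mat_cstar_norm k N" "X \<in> carrier_mat k k"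
  shows "M X = N X"
  using mat_cstar_norm_le assms by (meson order_antisym)

lemma mat_cstar_norm_eq:
  assumes "is_mat_cstar_norm k N" "X \<in> carrier_mat k k"
  shows "mat_cstar_norm k X = N X"
  unfolding mat_cstar_norm_def
  by (rule the_equality) (use assms mat_cstar_norm_unique in blast)+

end

theory Submission
  imports Defs
begin

text \<open>Write \<open>(W x)\<^sub>j = B (x\<^sub>j \<otimes> e\<^sub>j)\<close>, so that \<open>W x\<close> is a square summable family of vectors of
  \<open>\<ell>\<^sup>2(J, H)\<close> with norm at most \<open>\<parallel>B\<parallel> \<parallel>x\<parallel>\<close>, and let \<open>z\<close> be its transpose,
  \<open>(z\<^sub>i)\<^sub>j = (W x)\<^sub>j\<^sub>i = b\<^sub>i\<^sub>j x\<^sub>j\<close>. Then the \<open>i\<close>-th component of \<open>(A \<box> B) x\<close> is the \<open>i\<close>-th component of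
  \<open>A z\<^sub>i\<close>, which bounds the Schur product by \<open>\<parallel>A\<parallel> \<parallel>B\<parallel>\<close>. Both estimates are made one component of
  \<open>J\<close> at a time, so they hold verbatim with \<open>A\<close>, \<open>B\<close> replaced by \<open>k \<times> k\<close> blocks acting on
  \<open>k\<close>-tuples of vectors. A diagonal matrix unit shows that the norm is attained.\<close>

section \<open>Square summable families\<close>

lemma has_sum_norm_ell2:
  "((\<lambda>j. (norm (ell2_nth x j))\<^sup>2) has_sum (norm x)\<^sup>2) UNIV"
proof -
  have "(\<Sum>\<^sub>\<infinity>j. (norm (ell2_nth x j))\<^sup>2) = (norm x)\<^sup>2"
    by (simp add: norm_ell2.rep_eq infsum_nonneg)
  then show ?thesis using has_sum_infsum[OF ell2_nth_summable, of x] by simp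
qed

lemma has_sum_finite_sum:
  fixes f :: "'p \<Rightarrow> 'j \<Rightarrow> 'a::topological_comm_monoid_add"
  assumes "\<And>p. p \<in> P \<Longrightarrow> (f p has_sum s p) A"
  shows "((\<lambda>j. \<Sum>p\<in>P. f p j) has_sum sum s P) A"
  using assms by (induction P rule: infinite_finite_induct) (auto intro: has_sum_add)

text \<open>A squared \<open>ell2\<close> norm is the unordered sum of the squared norms of its
  components, and finite sums commute with unordered ones, so the comparison may be made index by
  index. The finite sums over \<open>P\<close> and \<open>Q\<close> make this available for tuples
  of vectors.\<close>

lemma sum_norm_ell2_le:
  assumes "\<And>j. (\<Sum>p\<in>P. (norm (ell2_nth (u p) j))\<^sup>2) \<le> c * (\<Sum>q\<in>Q. (norm (ell2_nth (v q) j))\<^sup>2)"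
  shows "(\<Sum>p\<in>P. (norm (u p))\<^sup>2) \<le> c * (\<Sum>q\<in>Q. (norm (v q))\<^sup>2)"
proof (rule has_sum_mono)
  show "((\<lambda>j. \<Sum>p\<in>P. (norm (ell2_nth (u p) j))\<^sup>2) has_sum (\<Sum>p\<in>P. (norm (u p))\<^sup>2)) UNIV"
    by (rule has_sum_finite_sum) (rule has_sum_norm_ell2)
  show "((\<lambda>j. c * (\<Sum>q\<in>Q. (norm (ell2_nth (v q) j))\<^sup>2)) has_sum c * (\<Sum>q\<in>Q. (norm (v q))\<^sup>2)) UNIV"
    by (intro has_sum_cmult_right has_sum_finite_sum has_sum_norm_ell2)
qed (rule assms)

lemma norm_ell2_le:
  assumes "0 \<le> c" "\<And>j. norm (ell2_nth x j) \<le> c * norm (ell2_nth y j)"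
  shows "norm x \<le> c * norm y"
proof -
  have "(norm (ell2_nth x j))\<^sup>2 \<le> c\<^sup>2 * (norm (ell2_nth y j))\<^sup>2" for j
    using power_mono[OF assms(2), of j 2] by (simp add: power_mult_distrib)
  then have "(norm x)\<^sup>2 \<le> (c * norm y)\<^sup>2"
    \<comment> \<open>One-element index sets turn the statement about tuples into one about single
      vectors.\<close>
    using sum_norm_ell2_le[where P = "{()}" and u = "\<lambda>_. x" and c = "c\<^sup>2" and Q = "{()}" and v = "\<lambda>_. y"] by (simp add: power_mult_distrib)
  then show ?thesis by (rule power2_le_imp_le) (simp add: assms(1))
qed

lemma norm_ell2_finite_support:
  assumes "finite F" "\<And>j. j \<notin> F \<Longrightarrow> ell2_nth x j = 0"
  shows "(norm x)\<^sup>2 = (\<Sum>j\<in>F. (norm (ell2_nth x j))\<^sup>2)"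
proof (rule has_sum_unique[OF has_sum_norm_ell2])
  show "((\<lambda>j. (norm (ell2_nth x j))\<^sup>2) has_sum (\<Sum>j\<in>F. (norm (ell2_nth x j))\<^sup>2)) UNIV"
    by (rule has_sum_finite_neutralI[OF assms(1)]) (use assms(2) in auto)
qed

text \<open>\<open>Ell2\<close> is specified only on square summable families. Domination by a known
  vector \<open>x\<close> supplies the summability, so every later vector built with
  \<open>Ell2\<close> is compared with an existing one.\<close>

lemma ell2_nth_Ell2:
  fixes x :: "('j, 'a::chilbert_space) ell2" and f :: "'j \<Rightarrow> 'b::chilbert_space"
  assumes "\<And>j. norm (f j) \<le> c * norm (ell2_nth x j)"
  shows "ell2_nth (Ell2 f) j = f j"
proof -
  have "(\<lambda>j. (norm (f j))\<^sup>2) summable_on UNIV"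
  proof (rule summable_on_comparison_test)
    show "(\<lambda>j. c\<^sup>2 * (norm (ell2_nth x j))\<^sup>2) summable_on UNIV"
      by (intro summable_on_cmult_right ell2_nth_summable)
    show "(norm (f j))\<^sup>2 \<le> c\<^sup>2 * (norm (ell2_nth x j))\<^sup>2" for j
      using power_mono[OF assms, of j 2] by (simp add: power_mult_distrib)
  qed simp
  then show ?thesis by (simp add: Ell2_inverse)
qed

lemma ell2_single_add: "ell2_single j (x + y) = ell2_single j x + ell2_single j y"
  by (rule ell2_eqI) (simp add: ell2_nth_single)

lemma ell2_single_scaleC: "ell2_single j (c *\<^sub>C x) = c *\<^sub>C ell2_single j x"
  by (rule ell2_eqI) (simp add: ell2_nth_single)

lemma bop_apply_add [simp]: "bop_apply T (x + y) = bop_apply T x + bop_apply T y"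
  by (simp add: linear_add bounded_linear.linear bounded_linear_bop_apply)

lemma bop_apply_0 [simp]: "bop_apply T 0 = 0"
  by (simp add: linear_0 bounded_linear.linear bounded_linear_bop_apply)

lemma bop_apply_sum: "bop_apply T (sum f S) = (\<Sum>s\<in>S. bop_apply T (f s))"
  by (induction S rule: infinite_finite_induct) auto

lemma bop_sum_apply: "bop_apply (sum f S) x = (\<Sum>s\<in>S. bop_apply (f s) x)"
  by (induction S rule: infinite_finite_induct) (auto simp: zero_bop.rep_eq plus_bop.rep_eq)

section \<open>Finite block operators\<close>

lift_definition bop_block :: "'j \<Rightarrow> 'j \<Rightarrow> 'h::chilbert_space bop \<Rightarrow> ('j, 'h) ell2 bop"
  is "\<lambda>p q f x. ell2_single p (f (ell2_nth x q))"
proof -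
  fix p q :: 'j and f :: "'h \<Rightarrow> 'h"
  assume f: "bounded_clinear f"
  then obtain K where K: "\<And>x. norm (f x) \<le> K * norm x" by (auto simp: bounded_clinear_def)
  \<comment> \<open>On the zero space the constant \<open>K\<close> may be negative, hence the
    absolute value.\<close>
  have "norm (f (ell2_nth x q)) \<le> \<bar>K\<bar> * norm x" for x :: "('j, 'h) ell2"
  proof -
    have "norm (f (ell2_nth x q)) \<le> \<bar>K\<bar> * norm (ell2_nth x q)"
      by (rule order_trans[OF K]) (simp add: mult_right_mono)
    also have "\<dots> \<le> \<bar>K\<bar> * norm x" by (intro mult_left_mono norm_ell2_nth_le) simp
    finally show ?thesis .
  qed
  with f show "bounded_clinear (\<lambda>x. ell2_single p (f (ell2_nth x q)))"
    unfolding bounded_clinear_def clinear_def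
    by (auto simp: norm_ell2_single ell2_single_add ell2_single_scaleC)
qed

lemma bop_entry_block:
  "bop_entry (bop_block p q S) i j = (if i = p \<and> j = q then S else 0)"
  by (rule bop_eqI) (auto simp: bop_entry.rep_eq bop_block.rep_eq ell2_nth_single zero_bop.rep_eq)

lemma norm_bop_block: "norm (bop_block p q S) = norm S"
proof (rule order_antisym)
  show "norm (bop_block p q S) \<le> norm S"
  proof (rule norm_bop_bound)
    fix x
    have "norm (bop_apply (bop_block p q S) x) \<le> norm S * norm (ell2_nth x q)"
      by (simp add: bop_block.rep_eq norm_ell2_single norm_bop_apply)
    also have "\<dots> \<le> norm S * norm x" by (intro mult_left_mono norm_ell2_nth_le norm_ge_zero)
    finally show "norm (bop_apply (bop_block p q S) x) \<le> norm S * norm x" .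
  qed simp
  show "norm S \<le> norm (bop_block p q S)"
  proof (rule norm_bop_bound)
    show "norm (bop_apply S h) \<le> norm (bop_block p q S) * norm h" for h
      using norm_bop_apply[of "bop_block p q S" "ell2_single q h"]
      by (simp add: bop_block.rep_eq norm_ell2_single ell2_nth_single)
  qed simp
qed

text \<open>A k by k operator matrix is placed in the upper left corner of an operator on
  \<open>(nat, 'h) ell2\<close>, with zeros elsewhere. All sizes then share one type, and the
  C*-algebra structure of \<open>bop\<close> applies directly.\<close>

definition block_op :: "nat \<Rightarrow> (nat \<Rightarrow> nat \<Rightarrow> 'h::chilbert_space bop) \<Rightarrow> (nat, 'h) ell2 bop" where
  "block_op k T = (\<Sum>p<k. \<Sum>q<k. bop_block p q (T p q))"

lemma ell2_nth_block_op:
  "ell2_nth (bop_apply (block_op k T) x) p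
    = (if p < k then \<Sum>q<k. bop_apply (T p q) (ell2_nth x q) else 0)"
proof -
  have "ell2_nth (bop_apply (block_op k T) x) p
      = (\<Sum>p'<k. \<Sum>q<k. if p = p' then bop_apply (T p' q) (ell2_nth x q) else 0)"
    by (simp add: block_op_def bop_sum_apply bop_block.rep_eq ell2_nth_single)
  also have "\<dots> = (\<Sum>p'<k. if p = p' then \<Sum>q<k. bop_apply (T p' q) (ell2_nth x q) else 0)"
    by (intro sum.cong) auto
  finally show ?thesis by simp
qed

lemma bop_entry_block_op: "bop_entry (block_op k T) p q = (if p < k \<and> q < k then T p q else 0)"
proof (rule bop_eqI)
  fix h
  have "(\<Sum>q'<k. bop_apply (T p q') (if q' = q then h else 0))
      = (\<Sum>q'<k. if q' = q then bop_apply (T p q') h else 0)"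
    by (rule sum.cong) auto
  then show "bop_apply (bop_entry (block_op k T) p q) h
      = bop_apply (if p < k \<and> q < k then T p q else 0) h"
    by (simp add: bop_entry.rep_eq ell2_nth_block_op ell2_nth_single zero_bop.rep_eq)
qed

lemma block_op_add: "block_op k S + block_op k T = block_op k (\<lambda>p q. S p q + T p q)"
  by (intro bop_eqI ell2_eqI)
    (simp add: plus_bop.rep_eq ell2_nth_block_op sum.distrib)

lemma block_op_scaleC: "c *\<^sub>C block_op k T = block_op k (\<lambda>p q. c *\<^sub>C T p q)"
  by (intro bop_eqI ell2_eqI)
    (simp add: scaleC_bop.rep_eq ell2_nth_block_op
      linear_sum[OF bounded_linear.linear[OF bounded_linear_scaleC]])

lemma block_op_mult:
  "block_op k S * block_op k T = block_op k (\<lambda>p q. \<Sum>l<k. S p l * T l q)"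
proof (intro bop_eqI ell2_eqI)
  fix x p
  show "ell2_nth (bop_apply (block_op k S * block_op k T) x) p
      = ell2_nth (bop_apply (block_op k (\<lambda>p q. \<Sum>l<k. S p l * T l q)) x) p"
    using sum.swap[of "\<lambda>l q. bop_apply (S p l) (bop_apply (T l q) (ell2_nth x q))" "{..<k}" "{..<k}"]
    by (simp add: times_bop.rep_eq ell2_nth_block_op bop_apply_sum bop_sum_apply)
qed

lemma star_block_op: "star (block_op k T) = block_op k (\<lambda>p q. star (T q p))"
  by (rule bop_entry_inject, intro ext) (simp add: bop_entry_star bop_entry_block_op)

text \<open>Coordinates from \<open>k\<close> on are annihilated, so a bound on k-tuples bounds the
  whole operator. Together with the converse \<open>block_op_apply_bound\<close> this identifies the
  norm of \<open>block_op k T\<close> with its norm on k-tuples.\<close>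

lemma norm_block_op_bound:
  assumes "0 \<le> c"
    and "\<And>u. (\<Sum>p<k. (norm (\<Sum>q<k. bop_apply (T p q) (u q)))\<^sup>2) \<le> c\<^sup>2 * (\<Sum>q<k. (norm (u q))\<^sup>2)"
  shows "norm (block_op k T) \<le> c"
proof (rule norm_bop_bound[OF assms(1)])
  fix x
  have "(norm (bop_apply (block_op k T) x))\<^sup>2 = (\<Sum>p<k. (norm (\<Sum>q<k. bop_apply (T p q) (ell2_nth x q)))\<^sup>2)"
    by (subst norm_ell2_finite_support[of "{..<k}"]) (auto simp: ell2_nth_block_op)
  also have "\<dots> \<le> c\<^sup>2 * (\<Sum>q<k. (norm (ell2_nth x q))\<^sup>2)" by (rule assms(2))
  also have "\<dots> \<le> c\<^sup>2 * (norm x)\<^sup>2"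
    by (intro mult_left_mono has_sum_mono2[OF has_sum_finite has_sum_norm_ell2]) auto
  finally have "(norm (bop_apply (block_op k T) x))\<^sup>2 \<le> (c * norm x)\<^sup>2"
    by (simp add: power_mult_distrib)
  then show "norm (bop_apply (block_op k T) x) \<le> c * norm x"
    by (rule power2_le_imp_le) (simp add: assms(1))
qed

lemma block_op_apply_bound:
  "(\<Sum>p<k. (norm (\<Sum>q<k. bop_apply (T p q) (u q)))\<^sup>2)
    \<le> (norm (block_op k T))\<^sup>2 * (\<Sum>q<k. (norm (u q))\<^sup>2)"
proof -
  \<comment> \<open>The tuple \<open>u\<close> is extended by zero to a vector over
    \<open>nat\<close>.\<close>
  define x where "x = (\<Sum>q<k. ell2_single q (u q))"
  have x: "ell2_nth x q = (if q < k then u q else 0)" for q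
    by (simp add: x_def ell2_nth_single)
  have "(norm (bop_apply (block_op k T) x))\<^sup>2 \<le> (norm (block_op k T) * norm x)\<^sup>2"
    by (intro power_mono norm_bop_apply norm_ge_zero)
  moreover have "(norm (bop_apply (block_op k T) x))\<^sup>2 = (\<Sum>p<k. (norm (\<Sum>q<k. bop_apply (T p q) (u q)))\<^sup>2)"
    by (subst norm_ell2_finite_support[of "{..<k}"]) (auto simp: ell2_nth_block_op x)
  moreover have "(norm x)\<^sup>2 = (\<Sum>q<k. (norm (u q))\<^sup>2)"
    by (subst norm_ell2_finite_support[of "{..<k}"]) (auto simp: x)
  ultimately show ?thesis by (simp add: power_mult_distrib)
qed

section \<open>The C*-norm of matrices over \<open>bmat\<close>\<close>

lemma bmat_op_sum: "bmat_op (sum f S) = (\<Sum>s\<in>S. bmat_op (f s))"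
  by (induction S rule: infinite_finite_induct) (auto simp: bmat_op_zero bmat_op_add)

definition mat_block_op :: "nat \<Rightarrow> ('j, 'h::chilbert_space) bmat mat \<Rightarrow> (nat, ('j, 'h) ell2) ell2 bop" where
  "mat_block_op k X = block_op k (\<lambda>p q. bmat_op (X $$ (p, q)))"

lemma block_op_cong:
  "(\<And>p q. p < k \<Longrightarrow> q < k \<Longrightarrow> S p q = T p q) \<Longrightarrow> block_op k S = block_op k T"
  by (simp add: block_op_def)

lemma mat_block_op_inject:
  assumes "X \<in> carrier_mat k k" "Y \<in> carrier_mat k k" "mat_block_op k X = mat_block_op k Y"
  shows "X = Y"
proof (rule eq_matI)
  fix i j assume "i < dim_row Y" "j < dim_col Y"
  then have "i < k" "j < k" using assms(2) by auto
  moreover have "bop_entry (mat_block_op k X) i j = bop_entry (mat_block_op k Y) i j"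
    by (simp add: assms(3))
  ultimately show "X $$ (i, j) = Y $$ (i, j)"
    by (intro bmat_eqI) (simp add: mat_block_op_def bop_entry_block_op)
qed (use assms in auto)

lemma mat_block_op_elem:
  assumes "i < k" "j < k"
  shows "mat_block_op k (mat_elem k i j a) = bop_block i j (bmat_op a)"
  by (rule bop_entry_inject, intro ext)
    (use assms in \<open>auto simp: mat_block_op_def bop_entry_block_op bop_entry_block mat_elem_def bmat_op_zero\<close>)

text \<open>\<open>mat_block_op k\<close> is an injective *-homomorphism into a C*-algebra of
  operators, so the operator norm pulls back to a C*-norm; the clause on diagonal corners is
  \<open>norm_bop_block\<close>. By uniqueness this computes the abstractly defined
  \<open>mat_cstar_norm\<close>.\<close>

lemma is_mat_cstar_norm_block_op:
  "is_mat_cstar_norm k (\<lambda>X::('j, 'h::chilbert_space) bmat mat. norm (mat_block_op k X))"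
proof -
  have add: "mat_block_op k (X + Y) = mat_block_op k X + mat_block_op k Y"
    if "X \<in> carrier_mat k k" "Y \<in> carrier_mat k k" for X Y :: "('j, 'h) bmat mat"
    unfolding mat_block_op_def block_op_add
    by (rule block_op_cong) (use that in \<open>auto simp: bmat_op_add\<close>)
  have mult: "mat_block_op k (X * Y) = mat_block_op k X * mat_block_op k Y"
    if "X \<in> carrier_mat k k" "Y \<in> carrier_mat k k" for X Y :: "('j, 'h) bmat mat"
    unfolding mat_block_op_def block_op_mult
    by (rule block_op_cong) (simp only: mat_mult_index[OF that] bmat_op_sum bmat_op_mult)
  have scale: "mat_block_op k (map_mat (\<lambda>a. c *\<^sub>C a) X) = c *\<^sub>C mat_block_op k X"
    if "X \<in> carrier_mat k k" for c and X :: "('j, 'h) bmat mat"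
    unfolding mat_block_op_def block_op_scaleC
    by (rule block_op_cong) (use that in \<open>auto simp: bmat_op_scaleC\<close>)
  have star: "mat_block_op k (mat_star X) = star (mat_block_op k X)"
    if "X \<in> carrier_mat k k" for X :: "('j, 'h) bmat mat"
    unfolding mat_block_op_def star_block_op
    by (rule block_op_cong) (use that in \<open>auto simp: mat_star_def bmat_op_star\<close>)
  have zero: "mat_block_op k (0\<^sub>m k k) = (0 :: (nat, ('j, 'h) ell2) ell2 bop)"
    by (rule bop_entry_inject, intro ext bop_eqI)
      (simp add: mat_block_op_def bop_entry_block_op bmat_op_zero, simp add: bop_entry.rep_eq zero_bop.rep_eq)
  have eq0: "mat_block_op k X = 0 \<longleftrightarrow> X = 0\<^sub>m k k" if "X \<in> carrier_mat k k" for X :: "('j, 'h) bmat mat"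
    using mat_block_op_inject[OF that zero_carrier_mat] zero by metis
  show ?thesis
    unfolding is_mat_cstar_norm_def
    by (auto simp: eq0 scale norm_scaleC add norm_triangle_ineq mult norm_mult_ineq mat_star_carrier
        star norm_star_mult_self mat_block_op_elem norm_bop_block norm_bmat_def)
qed

lemma mat_cstar_norm_bmat:
  "X \<in> carrier_mat k k \<Longrightarrow> mat_cstar_norm k X = norm (mat_block_op k X)"
  by (rule mat_cstar_norm_eq[OF is_mat_cstar_norm_block_op])

section \<open>The Schur product of operators\<close>

definition ell2_transpose ::
  "('i, ('j, 'h::chilbert_space) ell2) ell2 \<Rightarrow> ('j, ('i, 'h) ell2) ell2" where
  "ell2_transpose z = Ell2 (\<lambda>j. Ell2 (\<lambda>i. ell2_nth (ell2_nth z i) j))"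

lemma ell2_transpose_inner:
  "ell2_nth (Ell2 (\<lambda>i. ell2_nth (ell2_nth z i) j)) i = ell2_nth (ell2_nth z i) j"
  by (rule ell2_nth_Ell2[of _ 1 z]) (simp add: norm_ell2_nth_le)

text \<open>For fixed \<open>i\<close>, the sum over the finite set \<open>F\<close> is a partial
  sum of the squared norm of the i-th row of \<open>z\<close>. Summing over \<open>i\<close> needs
  only the exchange of a finite sum with an unordered one, and the bound, uniform in
  \<open>F\<close>, makes the outer family of the transpose square summable.\<close>

lemma ell2_transpose_L2_set:
  assumes "finite F"
  shows "L2_set (\<lambda>j. norm (Ell2 (\<lambda>i. ell2_nth (ell2_nth z i) j))) F \<le> norm z"
proof -
  have "(\<Sum>j\<in>F. (norm (Ell2 (\<lambda>i. ell2_nth (ell2_nth z i) j)))\<^sup>2) \<le> 1 * (\<Sum>_\<in>{()}. (norm z)\<^sup>2)"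
  proof (rule sum_norm_ell2_le)
    show "(\<Sum>j\<in>F. (norm (ell2_nth (Ell2 (\<lambda>i. ell2_nth (ell2_nth z i) j)) i))\<^sup>2)
        \<le> 1 * (\<Sum>_\<in>{()}. (norm (ell2_nth z i))\<^sup>2)" for i
      unfolding ell2_transpose_inner
      using has_sum_mono2[OF has_sum_finite[OF assms] has_sum_norm_ell2, of "ell2_nth z i"] by simp
  qed
  then show ?thesis by (simp add: L2_set_def real_le_lsqrt sum_nonneg)
qed

lemma ell2_nth_transpose_nth: "ell2_nth (ell2_transpose z) j = Ell2 (\<lambda>i. ell2_nth (ell2_nth z i) j)"
proof -
  have "(\<lambda>j. (norm (Ell2 (\<lambda>i. ell2_nth (ell2_nth z i) j)))\<^sup>2) summable_on UNIV"
    unfolding square_summable_iff_L2_set using ell2_transpose_L2_set by blast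
  then show ?thesis by (simp add: ell2_transpose_def Ell2_inverse)
qed

lemma ell2_nth_transpose:
  "ell2_nth (ell2_nth (ell2_transpose z) j) i = ell2_nth (ell2_nth z i) j"
  by (simp add: ell2_nth_transpose_nth ell2_transpose_inner)

lemma norm_ell2_transpose_le: "norm (ell2_transpose z) \<le> norm z"
  by (rule norm_ell2_leI) (simp add: ell2_nth_transpose_nth ell2_transpose_L2_set)

lemma ell2_transpose_sum: "ell2_transpose (sum f S) = (\<Sum>s\<in>S. ell2_transpose (f s))"
  by (intro ell2_eqI) (simp add: ell2_nth_transpose)

text \<open>For \<open>T\<close> in place of \<open>B\<close> this is the map \<open>W\<close> of
  the introduction: the diagonal embedding, sending \<open>x\<close> to the family of vectors
  \<open>ell2_single j (ell2_nth x j)\<close>, followed by \<open>T\<close> in each member.\<close>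

definition columns :: "('j, 'h::chilbert_space) ell2 bop \<Rightarrow> ('j, 'h) ell2 \<Rightarrow> ('j, ('j, 'h) ell2) ell2" where
  "columns T x = Ell2 (\<lambda>j. bop_apply T (ell2_single j (ell2_nth x j)))"

lemma norm_column: "norm (bop_apply T (ell2_single j h)) \<le> norm T * norm h"
  using norm_bop_apply[of T "ell2_single j h"] by (simp add: norm_ell2_single)

lemma ell2_nth_columns: "ell2_nth (columns T x) j = bop_apply T (ell2_single j (ell2_nth x j))"
  unfolding columns_def by (rule ell2_nth_Ell2) (rule norm_column)

lemma norm_columns_le: "norm (columns T x) \<le> norm T * norm x"
  by (rule norm_ell2_le) (simp_all add: ell2_nth_columns norm_column)

text \<open>\<open>S\<close> is applied to each member of the family, then the adjoint of the
  diagonal embedding keeps the i-th component of the i-th vector.\<close>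

definition diagonal_apply ::
  "('j, 'h::chilbert_space) ell2 bop \<Rightarrow> ('j, ('j, 'h) ell2) ell2 \<Rightarrow> ('j, 'h) ell2" where
  "diagonal_apply S z = Ell2 (\<lambda>i. ell2_nth (bop_apply S (ell2_nth z i)) i)"

lemma norm_diagonal_apply_nth: "norm (ell2_nth (bop_apply S y) i) \<le> norm S * norm y"
  by (rule order_trans[OF norm_ell2_nth_le norm_bop_apply])

lemma ell2_nth_diagonal_apply:
  "ell2_nth (diagonal_apply S z) i = ell2_nth (bop_apply S (ell2_nth z i)) i"
  unfolding diagonal_apply_def by (rule ell2_nth_Ell2) (rule norm_diagonal_apply_nth)

lemma norm_diagonal_apply_le: "norm (diagonal_apply S z) \<le> norm S * norm z"
  by (rule norm_ell2_le) (simp_all add: ell2_nth_diagonal_apply norm_diagonal_apply_nth)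

lemma diagonal_apply_sum: "diagonal_apply S (sum f Q) = (\<Sum>q\<in>Q. diagonal_apply S (f q))"
  by (rule ell2_eqI) (simp add: ell2_nth_diagonal_apply bop_apply_sum)

text \<open>With V the diagonal embedding and F the flip of the two indices, this is the
  factorization of the Schur product as V, then \<open>T\<close> in each member, then F, then
  \<open>S\<close> in each member, then the adjoint of V. V is isometric and F does not increase
  norms. \<open>Bop\<close> turns the raw functions back into operators, as \<open>columns\<close>
  and \<open>diagonal_apply\<close> require.\<close>

lift_definition schur_op ::
  "('j, 'h::chilbert_space) ell2 bop \<Rightarrow> ('j, 'h) ell2 bop \<Rightarrow> ('j, 'h) ell2 bop"
  is "\<lambda>f g x. diagonal_apply (Bop f) (ell2_transpose (columns (Bop g) x))"
proof -
  fix f g :: "('j, 'h) ell2 \<Rightarrow> ('j, 'h) ell2"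
  define S T where "S = Bop f" and "T = Bop g"
  have "diagonal_apply S (ell2_transpose (columns T (x + y)))
      = diagonal_apply S (ell2_transpose (columns T x)) + diagonal_apply S (ell2_transpose (columns T y))" for x y
  proof -
    have "ell2_nth (ell2_transpose (columns T (x + y))) i
        = ell2_nth (ell2_transpose (columns T x)) i + ell2_nth (ell2_transpose (columns T y)) i" for i
      by (rule ell2_eqI) (simp add: ell2_nth_transpose ell2_nth_columns ell2_single_add)
    then show ?thesis by (intro ell2_eqI) (simp add: ell2_nth_diagonal_apply)
  qed
  moreover have "diagonal_apply S (ell2_transpose (columns T (c *\<^sub>C x)))
      = c *\<^sub>C diagonal_apply S (ell2_transpose (columns T x))" for c x
  proof -
    have "ell2_nth (ell2_transpose (columns T (c *\<^sub>C x))) i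
        = c *\<^sub>C ell2_nth (ell2_transpose (columns T x)) i" for i
      by (rule ell2_eqI)
        (simp add: ell2_nth_transpose ell2_nth_columns ell2_single_scaleC bop_apply_scaleC)
    then show ?thesis by (intro ell2_eqI) (simp add: ell2_nth_diagonal_apply bop_apply_scaleC)
  qed
  moreover have "norm (diagonal_apply S (ell2_transpose (columns T x))) \<le> norm S * norm T * norm x" for x
  proof -
    have "norm (diagonal_apply S (ell2_transpose (columns T x))) \<le> norm S * norm (ell2_transpose (columns T x))"
      by (rule norm_diagonal_apply_le)
    also have "\<dots> \<le> norm S * (norm T * norm x)"
      by (intro mult_left_mono order_trans[OF norm_ell2_transpose_le norm_columns_le] norm_ge_zero)
    finally show ?thesis by (simp add: mult.assoc)
  qed
  ultimately show "bounded_clinear (\<lambda>x. diagonal_apply S (ell2_transpose (columns T x)))"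
    unfolding bounded_clinear_def clinear_def by blast
qed

lemma schur_op_apply:
  "bop_apply (schur_op S T) x = diagonal_apply S (ell2_transpose (columns T x))"
  by (simp add: schur_op.rep_eq bop_apply_inverse)

text \<open>On \<open>ell2_single j h\<close> only the j-th column survives. After transposition the
  i-th vector is supported at \<open>j\<close> with value \<open>bop_entry T i j\<close> applied to
  \<open>h\<close>, and the i-th component of its image under \<open>S\<close> is the product of the
  two entries.\<close>

lemma bop_entry_schur_op:
  fixes S T :: "('j, 'h::chilbert_space) ell2 bop"
  shows "bop_entry (schur_op S T) i j = bop_entry S i j * bop_entry T i j"
proof (rule bop_eqI)
  fix h :: 'h
  have "ell2_nth (ell2_transpose (columns T (ell2_single j h))) i
      = ell2_single j (ell2_nth (bop_apply T (ell2_single j h)) i)"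
  proof (rule ell2_eqI)
    have "ell2_single j' 0 = (0 :: ('j, 'h) ell2)" for j'
      by (rule ell2_eqI) (simp add: ell2_nth_single)
    then show "ell2_nth (ell2_nth (ell2_transpose (columns T (ell2_single j h))) i) j'
        = ell2_nth (ell2_single j (ell2_nth (bop_apply T (ell2_single j h)) i)) j'" for j'
      by (simp add: ell2_nth_transpose ell2_nth_columns ell2_nth_single)
  qed
  then show "bop_apply (bop_entry (schur_op S T) i j) h = bop_apply (bop_entry S i j * bop_entry T i j) h"
    by (simp add: bop_entry.rep_eq schur_op_apply ell2_nth_diagonal_apply times_bop.rep_eq)
qed

lemma norm_block_op_schur_le:
  fixes S T :: "nat \<Rightarrow> nat \<Rightarrow> ('j, 'h::chilbert_space) ell2 bop"
  shows "norm (block_op k (\<lambda>p q. \<Sum>l<k. schur_op (S p l) (T l q))) \<le> norm (block_op k S) * norm (block_op k T)"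
proof (rule norm_block_op_bound)
  fix u :: "nat \<Rightarrow> ('j, 'h) ell2"
  \<comment> \<open>The column families produced by row \<open>l\<close> of \<open>T\<close> from
    the whole tuple \<open>u\<close>. Additivity of transposition and of
    \<open>diagonal_apply\<close> lets the sum over \<open>q\<close> be carried out first.\<close>
  define w where "w l = (\<Sum>q<k. columns (T l q) (u q))" for l
  have "(\<Sum>q<k. bop_apply (\<Sum>l<k. schur_op (S p l) (T l q)) (u q))
      = (\<Sum>l<k. diagonal_apply (S p l) (ell2_transpose (w l)))" for p
    unfolding w_def bop_sum_apply schur_op_apply ell2_transpose_sum diagonal_apply_sum
    by (rule sum.swap)
  then have "(\<Sum>p<k. (norm (\<Sum>q<k. bop_apply (\<Sum>l<k. schur_op (S p l) (T l q)) (u q)))\<^sup>2)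
      = (\<Sum>p<k. (norm (\<Sum>l<k. diagonal_apply (S p l) (ell2_transpose (w l))))\<^sup>2)"
    by simp
  \<comment> \<open>At a fixed index \<open>i\<close>, the blocks of \<open>S\<close> act on the
    k-tuple of i-th members of the transposed families.\<close>
  also have "\<dots> \<le> (norm (block_op k S))\<^sup>2 * (\<Sum>l<k. (norm (ell2_transpose (w l)))\<^sup>2)"
  proof (rule sum_norm_ell2_le)
    fix i
    have "(\<Sum>p<k. (norm (ell2_nth (\<Sum>l<k. diagonal_apply (S p l) (ell2_transpose (w l))) i))\<^sup>2)
        = (\<Sum>p<k. (norm (ell2_nth (\<Sum>l<k. bop_apply (S p l) (ell2_nth (ell2_transpose (w l)) i)) i))\<^sup>2)"
      by (simp add: ell2_nth_diagonal_apply)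
    also have "\<dots> \<le> (\<Sum>p<k. (norm (\<Sum>l<k. bop_apply (S p l) (ell2_nth (ell2_transpose (w l)) i)))\<^sup>2)"
      by (intro sum_mono power_mono norm_ell2_nth_le norm_ge_zero)
    also have "\<dots> \<le> (norm (block_op k S))\<^sup>2 * (\<Sum>l<k. (norm (ell2_nth (ell2_transpose (w l)) i))\<^sup>2)"
      by (rule block_op_apply_bound)
    finally show "(\<Sum>p<k. (norm (ell2_nth (\<Sum>l<k. diagonal_apply (S p l) (ell2_transpose (w l))) i))\<^sup>2)
        \<le> (norm (block_op k S))\<^sup>2 * (\<Sum>l<k. (norm (ell2_nth (ell2_transpose (w l)) i))\<^sup>2)" .
  qed
  also have "\<dots> \<le> (norm (block_op k S))\<^sup>2 * (\<Sum>l<k. (norm (w l))\<^sup>2)"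
    by (intro mult_left_mono sum_mono power_mono norm_ell2_transpose_le norm_ge_zero) simp
  \<comment> \<open>At a fixed index \<open>j\<close>, the blocks of \<open>T\<close> act on the
    k-tuple of vectors \<open>ell2_single j (ell2_nth (u q) j)\<close>, whose norms are those of the
    components of \<open>u q\<close>.\<close>
  also have "\<dots> \<le> (norm (block_op k S))\<^sup>2 * ((norm (block_op k T))\<^sup>2 * (\<Sum>q<k. (norm (u q))\<^sup>2))"
  proof (rule mult_left_mono[OF sum_norm_ell2_le])
    fix j
    have "(\<Sum>l<k. (norm (ell2_nth (w l) j))\<^sup>2)
        = (\<Sum>l<k. (norm (\<Sum>q<k. bop_apply (T l q) (ell2_single j (ell2_nth (u q) j))))\<^sup>2)"
      by (simp add: w_def ell2_nth_columns)
    also have "\<dots> \<le> (norm (block_op k T))\<^sup>2 * (\<Sum>q<k. (norm (ell2_single j (ell2_nth (u q) j)))\<^sup>2)"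
      by (rule block_op_apply_bound)
    finally show "(\<Sum>l<k. (norm (ell2_nth (w l) j))\<^sup>2)
        \<le> (norm (block_op k T))\<^sup>2 * (\<Sum>q<k. (norm (ell2_nth (u q) j))\<^sup>2)"
      by (simp add: norm_ell2_single)
  qed simp
  finally show "(\<Sum>p<k. (norm (\<Sum>q<k. bop_apply (\<Sum>l<k. schur_op (S p l) (T l q)) (u q)))\<^sup>2)
      \<le> (norm (block_op k S) * norm (block_op k T))\<^sup>2 * (\<Sum>q<k. (norm (u q))\<^sup>2)"
    by (simp add: power_mult_distrib mult.assoc)
qed simp

section \<open>The Schur product of matrices\<close>

text \<open>\<open>schur_op\<close> is the bounded operator that the entrywise product defines,
  which places this product in the domain where \<open>Bmat\<close> is invertible.\<close>

lemma bmat_entry_schur: "bmat_entry (A \<box> B) i j = bmat_entry A i j * bmat_entry B i j"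
proof -
  have "(\<lambda>i j. bmat_entry A i j * bmat_entry B i j) = bop_entry (schur_op (bmat_op A) (bmat_op B))"
    by (intro ext) (simp add: bop_entry_schur_op bmat_entry_eq)
  then show ?thesis
    unfolding schur_product_def by (subst Bmat_inverse) (auto simp: bmat_represents_iff)
qed

lemma bmat_op_schur: "bmat_op (A \<box> B) = schur_op (bmat_op A) (bmat_op B)"
  by (rule bop_entry_inject, intro ext)
    (simp add: bop_entry_schur_op bmat_entry_eq[symmetric] bmat_entry_schur)

lemma cbilinear_schur: "cbilinear (\<box>)"
  unfolding cbilinear_def clinear_def
  by (auto simp: bmat_entry_inject[symmetric] fun_eq_iff bmat_entry_schur plus_bmat.rep_eq
      scaleC_bmat.rep_eq distrib_left distrib_right scaleC_mult_left scaleC_mult_right)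

lemma mat_cstar_norm_schur_le:
  assumes "A \<in> carrier_mat k k" "B \<in> carrier_mat k k"
  shows "mat_cstar_norm k (amplification (\<box>) k A B) \<le> mat_cstar_norm k A * mat_cstar_norm k B"
proof -
  have "mat_block_op k (amplification (\<box>) k A B)
      = block_op k (\<lambda>p q. \<Sum>l<k. schur_op (bmat_op (A $$ (p, l))) (bmat_op (B $$ (l, q))))"
    unfolding mat_block_op_def
    by (rule block_op_cong) (simp add: amplification_def bmat_op_sum bmat_op_schur)
  moreover have "amplification (\<box>) k A B \<in> carrier_mat k k" by (simp add: amplification_def)
  ultimately show ?thesis
    using assms norm_block_op_schur_le[of k "\<lambda>p q. bmat_op (A $$ (p, q))" "\<lambda>p q. bmat_op (B $$ (p, q))"]
    by (simp add: mat_cstar_norm_bmat mat_block_op_def)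
qed

section \<open>Upper and lower bounds for the completely bounded norm\<close>

lemma amplification_norm_schur_le: "amplification_norm (\<box>) k \<le> 1"
  unfolding amplification_norm_def
proof (rule SUP_least, clarify)
  fix A B :: "('a, 'b) bmat mat"
  assume AB: "A \<in> carrier_mat k k" "B \<in> carrier_mat k k" "mat_cstar_norm k A \<le> 1" "mat_cstar_norm k B \<le> 1"
  have "mat_cstar_norm k A * mat_cstar_norm k B \<le> 1 * 1"
    using AB by (intro mult_mono) (auto simp: mat_cstar_norm_bmat)
  then show "ereal (mat_cstar_norm k (amplification (\<box>) k A B)) \<le> 1"
    using mat_cstar_norm_schur_le[OF AB(1,2)] by simp
qed

lemma schur_idempotent_exists:
  assumes "\<exists>x :: 'h::chilbert_space. x \<noteq> 0"
  shows "\<exists>E :: ('j, 'h) bmat. norm E = 1 \<and> E \<box> E = E"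
proof -
  have "bounded_clinear (\<lambda>x::'h. x)"
    by (auto simp: bounded_clinear_def clinear_def intro: exI[of _ 1])
  then have I: "bop_apply (Bop (\<lambda>x::'h. x)) = (\<lambda>x. x)" by (simp add: Bop_inverse)
  \<comment> \<open>\<open>undefined\<close> serves as an arbitrary index in \<open>J\<close>, which
    is nonempty because it is a type; \<open>E\<close> carries the identity operator at this
    diagonal position.\<close>
  define E :: "('j, 'h) bmat" where "E = bmat_of_op (bop_block undefined undefined (Bop (\<lambda>x. x)))"
  have "norm (Bop (\<lambda>x::'h. x)) = 1"
  proof (rule order_antisym)
    show "norm (Bop (\<lambda>x::'h. x)) \<le> 1" by (rule norm_bop_bound) (simp_all add: I)
    \<comment> \<open>Here the assumption that \<open>H\<close> is nonzero enters: on the zero space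
      the identity has norm 0.\<close>
    obtain x :: 'h where "x \<noteq> 0" using assms by blast
    then show "1 \<le> norm (Bop (\<lambda>x::'h. x))" using norm_bop_apply[of "Bop (\<lambda>x. x)" x] by (simp add: I)
  qed
  then have "norm E = 1" by (simp add: E_def norm_bmat_def norm_bop_block)
  moreover have "Bop (\<lambda>x::'h. x) * Bop (\<lambda>x. x) = Bop (\<lambda>x. x)"
    by (rule bop_eqI) (simp add: times_bop.rep_eq I)
  then have "E \<box> E = E"
    by (simp add: bmat_entry_inject[symmetric] fun_eq_iff bmat_entry_schur E_def bmat_entry_of_op bop_entry_block)
  ultimately show ?thesis by blast
qed

text \<open>The amplification of size 1 already attains the bound: a 1 by 1 matrix with entry
  \<open>E\<close> has norm 1 and is reproduced by the product because
  \<open>E \<box> E = E\<close>.\<close>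

lemma amplification_norm_schur_1:
  assumes "\<exists>x :: 'h::chilbert_space. x \<noteq> 0"
  shows "1 \<le> amplification_norm ((\<box>) :: ('j, 'h) bmat \<Rightarrow> ('j, 'h) bmat \<Rightarrow> ('j, 'h) bmat) 1"
proof -
  obtain E :: "('j, 'h) bmat" where E: "norm E = 1" "E \<box> E = E"
    using schur_idempotent_exists[OF assms] by blast
  define X where "X = mat_elem 1 0 0 E"
  have X: "X \<in> carrier_mat 1 1" unfolding X_def by (rule mat_elem_carrier)
  have N: "mat_cstar_norm 1 X = 1"
    unfolding mat_cstar_norm_bmat[OF X] unfolding X_def
    using mat_norm_elem[OF is_mat_cstar_norm_block_op, of 0 1 0 E] E(1) by simp
  have "amplification (\<box>) 1 X X = X"
    by (rule eq_matI) (auto simp: amplification_def X_def mat_elem_def E(2))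
  then have "1 = ereal (mat_cstar_norm 1 (amplification (\<box>) 1 X X))" by (simp only: N one_ereal_def)
  also have "\<dots> \<le> amplification_norm ((\<box>) :: ('j, 'h) bmat \<Rightarrow> ('j, 'h) bmat \<Rightarrow> ('j, 'h) bmat) 1"
    unfolding amplification_norm_def by (rule SUP_upper2[of "(X, X)"]) (simp_all add: X N del: One_nat_def)
  finally show ?thesis .
qed

theorem theorem2p3:
  assumes "\<exists>x :: 'h::chilbert_space. x \<noteq> 0"
  shows "(\<forall>(A :: ('j, 'h) bmat) B i j. bmat_entry (A \<box> B) i j = bmat_entry A i j * bmat_entry B i j)
    \<and> cbilinear ((\<box>) :: ('j, 'h) bmat \<Rightarrow> ('j, 'h) bmat \<Rightarrow> ('j, 'h) bmat)
    \<and> completely_bounded ((\<box>) :: ('j, 'h) bmat \<Rightarrow> ('j, 'h) bmat \<Rightarrow> ('j, 'h) bmat)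
    \<and> cb_norm ((\<box>) :: ('j, 'h) bmat \<Rightarrow> ('j, 'h) bmat \<Rightarrow> ('j, 'h) bmat) = 1"
proof (intro conjI allI)
  let ?S = "(\<box>) :: ('j, 'h) bmat \<Rightarrow> ('j, 'h) bmat \<Rightarrow> ('j, 'h) bmat"
  show "completely_bounded ?S"
    unfolding completely_bounded_def
    by (rule exI[of _ 1]) (simp add: amplification_norm_schur_le one_ereal_def[symmetric])
  show "cb_norm ?S = 1"
    unfolding cb_norm_def
  proof (rule order_antisym)
    show "(SUP k\<in>{1..}. amplification_norm ?S k) \<le> 1"
      by (rule SUP_least) (rule amplification_norm_schur_le)
    show "1 \<le> (SUP k\<in>{1..}. amplification_norm ?S k)"
      by (rule SUP_upper2[of 1]) (simp_all add: amplification_norm_schur_1[OF assms, simplified])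
  qed
qed (rule bmat_entry_schur cbilinear_schur)+

end
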